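(* The Lie group of point symmetries of the system $(\ast)$ of six partial differential equations for $a(x,t),b(x,t),c(x,t)$ given in the context has as its Lie algebra the set of vector fields $$X=\xi_1\,\partial_x+\xi_2\,\partial_t+\phi_1\,\partial_a+\phi_2\,\partial_b+\phi_3\,\partial_c$$ whose coefficient functions are $$\xi_1=k_3x+k_1t+k_2,\qquad \xi_2=k_6x+k_4t+k_5,$$ $$\phi_1=2k_1c+k_7a,\qquad \phi_2=(2k_4-2k_3+k_7)\,b+2k_6c,\qquad \phi_3=(k_7+k_4-k_3)\,c+k_6a+k_1b,$$ where $k_1,\dots,k_7$ are arbitrary real constants.
   Context: Let $x,t$ be real independent variables and $a,b,c$ real dependent variables (functions of $(x,t)$); subscripts $x,t$ denote partial derivatives. The system $(\ast)$ is $$a_{xx}-b_{tt}=0,\qquad b_{xt}+c_{xx}=0,\qquad a_{xt}+c_{tt}=0,$$ $$a_xc_t+a_tb_t-a_tc_x-c_t^2+2c\,a_{xt}+b\,a_{tt}-a\,c_{xt}=0,$$ $$a_tb_x-c_xc_t+c\,a_{xx}-a\,c_{xx}-c\,c_{xt}-b\,c_{tt}=0,$$ $$a_xb_x-b_xc_t+b_tc_x-c_x^2+a\,b_{xx}+2c\,b_{xt}-b\,c_{xt}=0.$$ (It expresses the Einstein condition for the four-dimensional Walker metric $2(dx_1\circ dx_3+dx_2\circ dx_4)+a\,dx_3\circ dx_3+b\,dx_4\circ dx_4+2c\,dx_3\circ dx_4$ when $a,b,c$ depend only on $x=x_1$ and $t=x_2$.) Point symmetries are (local) transformations of the space of variables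 $(x,t,a,b,c)$ mapping solutions of the system to solutions. The Lie algebra of the point symmetry group consists of the infinitesimal symmetries: vector fields $X=\xi_1\partial_x+\xi_2\partial_t+\phi_1\partial_a+\phi_2\partial_b+\phi_3\partial_c$, with coefficients smooth functions of $(x,t,a,b,c)$, satisfying the infinitesimal invariance condition: writing the six equations as $\Delta_\mu=0$, $\mu=1,\dots,6$, where $\Delta_\mu$ are functions on the second-order jet space with coordinates $x,t,a,b,c$ and the first and second derivatives of $a,b,c$, one has $\mathrm{Pr}^{(2)}X[\Delta_\mu]=0$ for every $\mu$ at all points where $\Delta_1=\dots=\Delta_6=0$. Here $\mathrm{Pr}^{(2)}X$ is the standard second prolongation: with $(u^1,u^2,u^3)=(a,b,c)$, $(x^1,x^2)=(x,t)$, $$\mathrm{Pr}^{(2)}X=X+\sum_{\alpha=1}^3\ \sum_{1\le \#J\le 2}\phi_\alpha^J\,\partial_{u^\alpha_J},\qquad \phi_\alpha^J=D_J\Big(\phi_\alpha-\sum_{i=1}^2\xi_iu^\alpha_{i}\Big)+\sum_{i=1}^2\xi_iu^\alpha_{J,i},$$ where $J$ ranges over the symmetric multi-indices in $x,t$ of order $1$ and $2$, $D_J$ is the corresponding total derivative, $u^\alpha_i=\partial u^\alpha/\partial x^i$ and $u^\alpha_{J,i}=\partial u^\alpha_J/\partial x^i$. *)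

theory Defs
  imports "HOL-Analysis.Analysis" "HOL-Library.Groups_Big_Fun"
begin

primrec C_k :: "nat \<Rightarrow> ('v::real_normed_vector \<Rightarrow> 'w::real_normed_vector) \<Rightarrow> bool" where
  "C_k 0 f \<longleftrightarrow> continuous_on UNIV f"
| "C_k (Suc k) f \<longleftrightarrow>
     (\<forall>z. f differentiable (at z)) \<and> (\<forall>v. C_k k (\<lambda>z. frechet_derivative f (at z) v))"

definition smooth :: "('v::real_normed_vector \<Rightarrow> 'w::real_normed_vector) \<Rightarrow> bool" where
  "smooth f \<longleftrightarrow> (\<forall>k. C_k k f)"


datatype indep = Ind_x | Ind_t

datatype dep = Dep_a | Dep_b | Dep_c

text \<open>
  Coordinates on the jet space: \<open>Jet \<alpha> (m, n)\<close> is the coordinate of the derivative of the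
  dependent variable \<open>\<alpha>\<close> taken \<open>m\<close> times in \<open>x\<close> and \<open>n\<close> times in \<open>t\<close>; order 0 gives \<open>\<alpha>\<close> itself.
  All orders are kept because \<open>D_J\<close> with \<open>#J = 2\<close> introduces third-order coordinates, which cancel
  in the prolongation coefficients. Functions on the second-order jet space are functions that
  only involve the coordinates with \<open>m + n \<le> 2\<close>.
\<close>

datatype coord = Base indep | Jet dep "nat \<times> nat"

type_synonym jet = "coord \<Rightarrow> real"

text \<open>Points \<open>(x, t, a, b, c)\<close>, and also tangent vectors \<open>(\<xi>\<^sub>1, \<xi>\<^sub>2, \<phi>\<^sub>1, \<phi>\<^sub>2, \<phi>\<^sub>3)\<close>.\<close>

type_synonym point = "real \<times> real \<times> real \<times> real \<times> real"

fun indep_comp :: "indep \<Rightarrow> point \<Rightarrow> real" where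
  "indep_comp Ind_x (x, t, a, b, c) = x"
| "indep_comp Ind_t (x, t, a, b, c) = t"

fun dep_comp :: "dep \<Rightarrow> point \<Rightarrow> real" where
  "dep_comp Dep_a (x, t, a, b, c) = a"
| "dep_comp Dep_b (x, t, a, b, c) = b"
| "dep_comp Dep_c (x, t, a, b, c) = c"

definition base_point :: "jet \<Rightarrow> point" where
  "base_point p = (p (Base Ind_x), p (Base Ind_t),
     p (Jet Dep_a (0, 0)), p (Jet Dep_b (0, 0)), p (Jet Dep_c (0, 0)))"

fun incr :: "indep \<Rightarrow> nat \<times> nat \<Rightarrow> nat \<times> nat" where
  "incr Ind_x (m, n) = (Suc m, n)"
| "incr Ind_t (m, n) = (m, Suc n)"

definition partial :: "coord \<Rightarrow> (jet \<Rightarrow> real) \<Rightarrow> jet \<Rightarrow> real" where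
  "partial v F p = deriv (\<lambda>s. F (p(v := s))) (p v)"

text \<open>
  \<open>Sum_any\<close> adds up the finitely many nonzero terms: a function of finite order depends on only
  finitely many jet coordinates.
\<close>

definition total_deriv :: "indep \<Rightarrow> (jet \<Rightarrow> real) \<Rightarrow> jet \<Rightarrow> real" where
  "total_deriv i F p = partial (Base i) F p
     + Sum_any (\<lambda>(\<alpha>, J). p (Jet \<alpha> (incr i J)) * partial (Jet \<alpha> J) F p)"

text \<open>The order of composition is immaterial, as total derivatives commute on smooth functions.\<close>

fun total_deriv_multi :: "nat \<times> nat \<Rightarrow> (jet \<Rightarrow> real) \<Rightarrow> jet \<Rightarrow> real" where
  "total_deriv_multi (m, n) F = (total_deriv Ind_x ^^ m) ((total_deriv Ind_t ^^ n) F)"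

definition characteristic :: "(point \<Rightarrow> point) \<Rightarrow> dep \<Rightarrow> jet \<Rightarrow> real" where
  "characteristic X \<alpha> p = dep_comp \<alpha> (X (base_point p))
     - (\<Sum>i\<in>UNIV. indep_comp i (X (base_point p)) * p (Jet \<alpha> (incr i (0, 0))))"

definition prolong_coeff :: "(point \<Rightarrow> point) \<Rightarrow> dep \<Rightarrow> nat \<times> nat \<Rightarrow> jet \<Rightarrow> real" where
  "prolong_coeff X \<alpha> J p = total_deriv_multi J (characteristic X \<alpha>) p
     + (\<Sum>i\<in>UNIV. indep_comp i (X (base_point p)) * p (Jet \<alpha> (incr i J)))"

definition prolong2 :: "(point \<Rightarrow> point) \<Rightarrow> (jet \<Rightarrow> real) \<Rightarrow> jet \<Rightarrow> real" where
  "prolong2 X F p =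
     (\<Sum>i\<in>UNIV. indep_comp i (X (base_point p)) * partial (Base i) F p)
   + (\<Sum>\<alpha>\<in>UNIV. dep_comp \<alpha> (X (base_point p)) * partial (Jet \<alpha> (0, 0)) F p)
   + (\<Sum>\<alpha>\<in>UNIV. \<Sum>J | 1 \<le> fst J + snd J \<and> fst J + snd J \<le> 2.
        prolong_coeff X \<alpha> J p * partial (Jet \<alpha> J) F p)"

text \<open>
  Second-order systems \<open>\<Delta> = 0\<close> are given by the set of their left-hand sides \<open>\<Delta>\<close>. The jet \<open>p\<close> below
  ranges over jets of all orders, but only its coordinates of order at most 2 matter.
\<close>

definition infinitesimal_symmetry :: "(jet \<Rightarrow> real) set \<Rightarrow> (point \<Rightarrow> point) \<Rightarrow> bool" where
  "infinitesimal_symmetry S X \<longleftrightarrow> smooth X \<and>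
     (\<forall>\<Delta>\<in>S. \<forall>p. (\<forall>\<Delta>'\<in>S. \<Delta>' p = 0) \<longrightarrow> prolong2 X \<Delta> p = 0)"

definition point_symmetry_algebra :: "(jet \<Rightarrow> real) set \<Rightarrow> (point \<Rightarrow> point) set" where
  "point_symmetry_algebra S = {X. infinitesimal_symmetry S X}"


abbreviation "a_0 \<equiv> Jet Dep_a (0, 0)"
abbreviation "a_x \<equiv> Jet Dep_a (1, 0)"
abbreviation "a_t \<equiv> Jet Dep_a (0, 1)"
abbreviation "a_xx \<equiv> Jet Dep_a (2, 0)"
abbreviation "a_xt \<equiv> Jet Dep_a (1, 1)"
abbreviation "a_tt \<equiv> Jet Dep_a (0, 2)"
abbreviation "b_0 \<equiv> Jet Dep_b (0, 0)"
abbreviation "b_x \<equiv> Jet Dep_b (1, 0)"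
abbreviation "b_t \<equiv> Jet Dep_b (0, 1)"
abbreviation "b_xx \<equiv> Jet Dep_b (2, 0)"
abbreviation "b_xt \<equiv> Jet Dep_b (1, 1)"
abbreviation "b_tt \<equiv> Jet Dep_b (0, 2)"
abbreviation "c_0 \<equiv> Jet Dep_c (0, 0)"
abbreviation "c_x \<equiv> Jet Dep_c (1, 0)"
abbreviation "c_t \<equiv> Jet Dep_c (0, 1)"
abbreviation "c_xx \<equiv> Jet Dep_c (2, 0)"
abbreviation "c_xt \<equiv> Jet Dep_c (1, 1)"
abbreviation "c_tt \<equiv> Jet Dep_c (0, 2)"

definition walker_einstein_system :: "(jet \<Rightarrow> real) set" where
  "walker_einstein_system =
    {(\<lambda>p. p a_xx - p b_tt),
     (\<lambda>p. p b_xt + p c_xx),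
     (\<lambda>p. p a_xt + p c_tt),
     (\<lambda>p. p a_x * p c_t + p a_t * p b_t - p a_t * p c_x - (p c_t)\<^sup>2
          + 2 * p c_0 * p a_xt + p b_0 * p a_tt - p a_0 * p c_xt),
     (\<lambda>p. p a_t * p b_x - p c_x * p c_t + p c_0 * p a_xx - p a_0 * p c_xx
          - p c_0 * p c_xt - p b_0 * p c_tt),
     (\<lambda>p. p a_x * p b_x - p b_x * p c_t + p b_t * p c_x - (p c_x)\<^sup>2
          + p a_0 * p b_xx + 2 * p c_0 * p b_xt - p b_0 * p c_xt)}"

end

theory Submission
  imports Defs
begin

text \<open>
  The invariance conditions are only evaluated at jets whose second derivatives vanish and whose
  first derivatives satisfy the three quadratic equations that then remain of the system. Along
  two-dimensional linear spaces of such first derivatives, with parameters \<open>u, v\<close>, every condition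
  is a cubic polynomial in \<open>u, v\<close>, all of whose coefficients vanish. The three linear equations
  give relations with constant coefficients between second derivatives of the field. With these,
  the cubic part of the other three gives \<open>\<xi>\<^sub>b = \<tau>\<^sub>a = 0\<close>, \<open>\<xi>\<^sub>a = \<tau>\<^sub>c\<close>, \<open>\<xi>\<^sub>c = \<tau>\<^sub>b\<close>; differentiating
  this removes the second derivatives in the fibre directions, so that the quadratic part reduces
  to the expected relations between the first derivatives of \<open>\<phi>\<close> and those of \<open>\<xi>, \<tau>\<close>, and the
  linear part to \<open>\<phi>\<^sub>x = \<phi>\<^sub>t = 0\<close>. Differentiating these relations shows that the field is affine. No
  genericity of the base point is needed. The remaining constants of the affine field are found
  from jets over the origin with nonzero second derivatives. Conversely, for the fields of the
  theorem the prolongation of each equation is a combination of the equations.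
\<close>

section \<open>Second derivatives on normed spaces\<close>

lemma C_k_const: "C_k k (\<lambda>z. c)"
  by (induction k arbitrary: c) auto

lemma C_k_bounded_linear_comp:
  assumes "bounded_linear L" "C_k k f"
  shows "C_k k (\<lambda>z. L (f z))"
  using assms(2)
proof (induction k arbitrary: f)
  case 0
  then show ?case
    using assms(1) by (simp add: bounded_linear.continuous_on)
next
  case (Suc k)
  have "((\<lambda>z. L (f z)) has_derivative (\<lambda>v. L (frechet_derivative f (at z) v))) (at z)" for z
    using Suc.prems by (auto intro!: bounded_linear.has_derivative [OF assms(1)] simp: frechet_derivative_works [symmetric])
  then have "(\<lambda>z. L (f z)) differentiable (at z)"
    and "frechet_derivative (\<lambda>z. L (f z)) (at z) = (\<lambda>v. L (frechet_derivative f (at z) v))" for z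
    by (auto simp: differentiable_def frechet_derivative_at [symmetric])
  then show ?case
    using Suc by simp
qed

text \<open>The derivative is \<open>L\<close> at every point, so each directional derivative is a
  constant function and a case distinction on the order replaces an induction.\<close>

lemma smooth_affine:
  assumes "bounded_linear L"
  shows "smooth (\<lambda>z. L z + w)"
proof -
  have D: "((\<lambda>z. L z + w) has_derivative L) (at z)" for z
    using bounded_linear_imp_has_derivative [OF assms] by (auto intro!: derivative_eq_intros)
  have "C_k k (\<lambda>z. L z + w)" for k
  proof (cases k)
    case 0
    then show ?thesis
      using D by (auto intro!: continuous_at_imp_continuous_on has_derivative_continuous)
  next
    case (Suc n)
    then show ?thesis
      using D by (auto simp: C_k_const differentiable_def frechet_derivative_at [OF D, symmetric])
  qed
  then show ?thesis
    by (simp add: smooth_def)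
qed

section \<open>Symmetry of second derivatives through second differences\<close>

lemma DERIV_along_line:
  assumes "g differentiable (at (z + s *\<^sub>R v))"
  shows "((\<lambda>s. g (z + s *\<^sub>R v)) has_real_derivative frechet_derivative g (at (z + s *\<^sub>R v)) v) (at s)"
proof -
  let ?D = "frechet_derivative g (at (z + s *\<^sub>R v))"
  have g: "(g has_derivative ?D) (at (z + s *\<^sub>R v))"
    using assms by (simp add: frechet_derivative_works)
  have "((\<lambda>s. z + s *\<^sub>R v) has_derivative (\<lambda>h. h *\<^sub>R v)) (at s)"
    by (auto intro!: derivative_eq_intros)
  from diff_chain_at [OF this g] have "((\<lambda>s. g (z + s *\<^sub>R v)) has_derivative (\<lambda>h. ?D (h *\<^sub>R v))) (at s)"
    by (simp add: o_def)
  moreover have "?D (h *\<^sub>R v) = ?D v * h" for h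
    using linear_frechet_derivative [OF assms] by (simp add: linear_cmul)
  ultimately show ?thesis
    by (simp add: has_field_derivative_def mult_commute_abs)
qed

text \<open>The mean value theorem is applied twice: first to the difference of \<open>g\<close>
  along two parallel segments in direction \<open>v\<close>, then to the resulting directional
  derivative along a segment in direction \<open>w\<close>.\<close>

lemma second_difference_mean_value:
  fixes g :: "'a::real_normed_vector \<Rightarrow> real" and z v w :: 'a and h :: real
  assumes g: "C_k 2 g" and "0 < h"
  obtains s t :: real where "0 < s" "s < h" "0 < t" "t < h"
    "g (z + h *\<^sub>R v + h *\<^sub>R w) - g (z + h *\<^sub>R v) - g (z + h *\<^sub>R w) + g z
      = h * h * frechet_derivative (\<lambda>y. frechet_derivative g (at y) v) (at (z + s *\<^sub>R v + t *\<^sub>R w)) w"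
proof -
  have g0: "g differentiable (at y)" for y
    using g by (simp add: numeral_2_eq_2)
  have g1: "(\<lambda>y. frechet_derivative g (at y) v) differentiable (at y)" for y
    using g by (simp add: numeral_2_eq_2)
  let ?f = "\<lambda>s. g ((z + h *\<^sub>R w) + s *\<^sub>R v) - g (z + s *\<^sub>R v)"
  have "(?f has_real_derivative frechet_derivative g (at ((z + h *\<^sub>R w) + s *\<^sub>R v)) v
           - frechet_derivative g (at (z + s *\<^sub>R v)) v) (at s)" for s
    by (intro DERIV_diff DERIV_along_line g0)
  from MVT2 [OF \<open>0 < h\<close> this] obtain s where s: "0 < s" "s < h"
    "?f h - ?f 0 = h * (frechet_derivative g (at ((z + h *\<^sub>R w) + s *\<^sub>R v)) v
           - frechet_derivative g (at (z + s *\<^sub>R v)) v)"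
    by auto
  from MVT2 [OF \<open>0 < h\<close> DERIV_along_line [where z = "z + s *\<^sub>R v" and v = w, OF g1]]
  obtain t where t: "0 < t" "t < h"
    "frechet_derivative g (at (z + s *\<^sub>R v + h *\<^sub>R w)) v - frechet_derivative g (at (z + s *\<^sub>R v + 0 *\<^sub>R w)) v
      = h * frechet_derivative (\<lambda>y. frechet_derivative g (at y) v) (at (z + s *\<^sub>R v + t *\<^sub>R w)) w"
    by auto
  show ?thesis
    using s t that [of s t] by (simp add: add_ac)
qed

text \<open>Each quotient is a second derivative at an intermediate point; these points converge to
  \<open>z\<close>, and the second derivative is continuous there.\<close>

lemma second_difference_quotient_tendsto:
  fixes g :: "'a::real_normed_vector \<Rightarrow> real" and z v w :: 'a
  assumes g: "C_k 2 g" and h: "h \<longlonglongrightarrow> (0::real)" "\<And>n. 0 < h n"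
  shows "(\<lambda>n. (g (z + h n *\<^sub>R v + h n *\<^sub>R w) - g (z + h n *\<^sub>R v) - g (z + h n *\<^sub>R w) + g z) / (h n * h n))
      \<longlonglongrightarrow> frechet_derivative (\<lambda>y. frechet_derivative g (at y) v) (at z) w"
    (is "?\<Delta> \<longlonglongrightarrow> ?D z")
proof -
  have "\<exists>s t. 0 < s \<and> s < h n \<and> 0 < t \<and> t < h n \<and> ?\<Delta> n = ?D (z + s *\<^sub>R v + t *\<^sub>R w)" for n
  proof -
    obtain s t where "0 < s" "s < h n" "0 < t" "t < h n"
      "g (z + h n *\<^sub>R v + h n *\<^sub>R w) - g (z + h n *\<^sub>R v) - g (z + h n *\<^sub>R w) + g z
        = h n * h n * ?D (z + s *\<^sub>R v + t *\<^sub>R w)"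
      using second_difference_mean_value [OF g h(2)] .
    then show ?thesis
      by auto
  qed
  then obtain s t where st: "\<And>n. 0 < s n" "\<And>n. s n < h n" "\<And>n. 0 < t n" "\<And>n. t n < h n"
    and eq: "\<And>n. ?\<Delta> n = ?D (z + s n *\<^sub>R v + t n *\<^sub>R w)"
    by metis
  have "s \<longlonglongrightarrow> 0" "t \<longlonglongrightarrow> 0"
    using st by (auto intro!: real_tendsto_sandwich [OF _ _ tendsto_const h(1)] always_eventually less_imp_le)
  then have "(\<lambda>n. z + s n *\<^sub>R v + t n *\<^sub>R w) \<longlonglongrightarrow> z + 0 *\<^sub>R v + 0 *\<^sub>R w"
    by (intro tendsto_intros)
  moreover have "isCont ?D z"
    using g by (simp add: numeral_2_eq_2 continuous_on_eq_continuous_at)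
  ultimately show ?thesis
    unfolding eq using isCont_tendsto_compose [of z ?D] by simp
qed

text \<open>The second difference is symmetric in \<open>v\<close> and \<open>w\<close>, hence so is
  the limit of its quotients.\<close>

lemma symmetric_second_frechet_derivative:
  fixes g :: "'a::real_normed_vector \<Rightarrow> real"
  assumes g: "C_k 2 g"
  shows "frechet_derivative (\<lambda>y. frechet_derivative g (at y) v) (at z) w
       = frechet_derivative (\<lambda>y. frechet_derivative g (at y) w) (at z) v"
proof -
  define h where "h n = 1 / real (Suc n)" for n
  have h: "h \<longlonglongrightarrow> 0" "\<And>n. 0 < h n"
    using LIMSEQ_Suc [OF lim_1_over_n] by (auto simp: h_def [abs_def])
  show ?thesis
    using LIMSEQ_unique [OF second_difference_quotient_tendsto [OF g h, of z v w]]
      second_difference_quotient_tendsto [OF g h, of z w v]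
    by (simp add: algebra_simps)
qed

section \<open>Partial and total derivatives on jet space\<close>

text \<open>Coordinates of order at least 1 get the zero vector, because changing them leaves the
  base point fixed. Thus \<open>base_point_upd\<close> holds uniformly for all coordinates.\<close>

fun coord_dir :: "coord \<Rightarrow> point" where
  "coord_dir (Base Ind_x) = (1, 0, 0, 0, 0)"
| "coord_dir (Base Ind_t) = (0, 1, 0, 0, 0)"
| "coord_dir (Jet Dep_a (0, 0)) = (0, 0, 1, 0, 0)"
| "coord_dir (Jet Dep_b (0, 0)) = (0, 0, 0, 1, 0)"
| "coord_dir (Jet Dep_c (0, 0)) = (0, 0, 0, 0, 1)"
| "coord_dir (Jet \<alpha> (m, n)) = 0"

definition pd :: "coord \<Rightarrow> (point \<Rightarrow> real) \<Rightarrow> point \<Rightarrow> real" where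
  "pd v g z = frechet_derivative g (at z) (coord_dir v)"

lemma C_k_pd: "C_k (Suc k) g \<Longrightarrow> C_k k (pd v g)"
  by (simp add: pd_def [abs_def] del: split_paired_All)

lemma C_k_differentiable: "C_k (Suc k) g \<Longrightarrow> g differentiable (at z)"
  by simp

lemma pd_commute: "C_k 2 g \<Longrightarrow> pd v (pd w g) z = pd w (pd v g) z"
  by (simp add: pd_def [abs_def] symmetric_second_frechet_derivative)

lemma pd_const [simp]: "pd v (\<lambda>z. c) z = 0"
  by (simp add: pd_def)

lemma base_point_upd: "base_point (p(v := s)) = base_point p + (s - p v) *\<^sub>R coord_dir v"
  by (cases v rule: coord_dir.cases) (auto simp: base_point_def)

lemma UNIV_indep: "UNIV = {Ind_x, Ind_t}"
  using indep.exhaust by auto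

lemma UNIV_dep: "UNIV = {Dep_a, Dep_b, Dep_c}"
  using dep.exhaust by auto

text \<open>The first condition makes the sum in \<open>total_deriv\<close> have finite support,
  without which \<open>Sum_any\<close> would default to 0; the second gives the sum and product
  rules for \<open>partial\<close>.\<close>

definition jet_differentiable :: "(jet \<Rightarrow> real) \<Rightarrow> bool" where
  "jet_differentiable F \<longleftrightarrow>
     (\<exists>V. finite V \<and> (\<forall>p v s. v \<notin> V \<longrightarrow> F (p(v := s)) = F p)) \<and>
     (\<forall>p v. (\<lambda>s. F (p(v := s))) field_differentiable at (p v))"

lemma jet_differentiableD:
  "jet_differentiable F \<Longrightarrow> ((\<lambda>s. F (p(v := s))) has_real_derivative partial v F p) (at (p v))"
  by (simp add: jet_differentiable_def partial_def DERIV_deriv_iff_field_differentiable)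

lemma partial_eqI: "((\<lambda>s. F (p(v := s))) has_real_derivative D) (at (p v)) \<Longrightarrow> partial v F p = D"
  by (simp add: partial_def DERIV_imp_deriv)

lemma jet_differentiable_binop:
  assumes "jet_differentiable F" "jet_differentiable G"
    and "\<And>p v. (\<lambda>s. H (F (p(v := s))) (G (p(v := s)))) field_differentiable at (p v)"
  shows "jet_differentiable (\<lambda>p. H (F p) (G p))"
proof -
  from assms obtain V W where "finite V" "finite W"
    "\<And>p v s. v \<notin> V \<Longrightarrow> F (p(v := s)) = F p" "\<And>p v s. v \<notin> W \<Longrightarrow> G (p(v := s)) = G p"
    unfolding jet_differentiable_def by metis
  then show ?thesis
    using assms(3) unfolding jet_differentiable_def by (auto intro!: exI [of _ "V \<union> W"])
qed

lemma jet_differentiable_add [simp]: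
  "jet_differentiable F \<Longrightarrow> jet_differentiable G \<Longrightarrow> jet_differentiable (\<lambda>p. F p + G p)"
  by (rule jet_differentiable_binop [where H = "(+)"])
    (auto intro!: Derivative.field_differentiable_add simp: jet_differentiable_def)

lemma jet_differentiable_diff [simp]:
  "jet_differentiable F \<Longrightarrow> jet_differentiable G \<Longrightarrow> jet_differentiable (\<lambda>p. F p - G p)"
  by (rule jet_differentiable_binop [where H = "(-)"])
    (auto intro!: Derivative.field_differentiable_diff simp: jet_differentiable_def)

lemma jet_differentiable_mult [simp]:
  "jet_differentiable F \<Longrightarrow> jet_differentiable G \<Longrightarrow> jet_differentiable (\<lambda>p. F p * G p)"
  by (rule jet_differentiable_binop [where H = "(*)"])
    (auto intro!: Derivative.field_differentiable_mult simp: jet_differentiable_def)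

lemma jet_differentiable_coord [simp]: "jet_differentiable (\<lambda>p. p w)"
  unfolding jet_differentiable_def
proof (intro conjI exI [of _ "{w}"] allI)
  show "(\<lambda>s. (p(v := s)) w) field_differentiable at (p v)" for p v
    by (cases "v = w") auto
qed auto

lemma DERIV_base_point:
  assumes "C_k (Suc k) g"
  shows "((\<lambda>s. g (base_point (p(v := s)))) has_real_derivative pd v g (base_point p)) (at (p v))"
proof -
  \<comment> \<open>The line is shifted so that its parameter is the value of the coordinate
    \<open>v\<close> itself and the base point of \<open>p\<close> is reached at
    \<open>s = p v\<close>.\<close>
  have "((\<lambda>s. g ((base_point p - p v *\<^sub>R coord_dir v) + s *\<^sub>R coord_dir v))
      has_real_derivative pd v g (base_point p)) (at (p v))"
    using DERIV_along_line [of g "base_point p - p v *\<^sub>R coord_dir v" "p v" "coord_dir v"]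
      C_k_differentiable [OF assms]
    by (simp add: pd_def)
  then show ?thesis
    by (simp add: base_point_upd algebra_simps)
qed

lemma jet_differentiable_base_point:
  assumes "C_k (Suc k) g"
  shows "jet_differentiable (\<lambda>p. g (base_point p))"
  unfolding jet_differentiable_def
proof (intro conjI exI [of _ "{Base Ind_x, Base Ind_t, a_0, b_0, c_0}"] allI impI)
  show "(\<lambda>s. g (base_point (p(v := s)))) field_differentiable at (p v)" for p v
    using DERIV_base_point [OF assms] by (auto simp: field_differentiable_def)
qed (auto simp: base_point_def)

lemma partial_base_point: "C_k (Suc k) g \<Longrightarrow> partial v (\<lambda>p. g (base_point p)) p = pd v g (base_point p)"
  by (rule partial_eqI) (rule DERIV_base_point)

lemma partial_coord: "partial v (\<lambda>p. p w) p = (if v = w then 1 else 0)"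
  by (rule partial_eqI) auto

lemma partial_add:
  "jet_differentiable F \<Longrightarrow> jet_differentiable G \<Longrightarrow> partial v (\<lambda>p. F p + G p) p = partial v F p + partial v G p"
  by (rule partial_eqI) (intro DERIV_add jet_differentiableD)

lemma partial_diff:
  "jet_differentiable F \<Longrightarrow> jet_differentiable G \<Longrightarrow> partial v (\<lambda>p. F p - G p) p = partial v F p - partial v G p"
  by (rule partial_eqI) (intro DERIV_diff jet_differentiableD)

lemma partial_mult:
  assumes "jet_differentiable F" "jet_differentiable G"
  shows "partial v (\<lambda>p. F p * G p) p = partial v F p * G p + F p * partial v G p"
  using DERIV_mult [OF jet_differentiableD [OF assms(1), of p v] jet_differentiableD [OF assms(2), of p v]]
  by (intro partial_eqI) (simp add: algebra_simps)

text \<open>A partial derivative vanishes in every coordinate outside the finite set on which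
  \<open>F\<close> depends.\<close>

lemma finite_jet_support:
  assumes "jet_differentiable F"
  shows "finite {k. (case k of (\<alpha>, J) \<Rightarrow> p (Jet \<alpha> (incr i J)) * partial (Jet \<alpha> J) F p) \<noteq> 0}"
proof -
  from assms obtain V where V: "finite V" "\<And>p v s. v \<notin> V \<Longrightarrow> F (p(v := s)) = F p"
    unfolding jet_differentiable_def by metis
  have partial_eq_0: "partial v F p = 0" if "v \<notin> V" for v
    using V that by (intro partial_eqI) simp
  then have "{k. (case k of (\<alpha>, J) \<Rightarrow> p (Jet \<alpha> (incr i J)) * partial (Jet \<alpha> J) F p) \<noteq> 0}
      \<subseteq> (\<lambda>(\<alpha>, J). Jet \<alpha> J) -` V"
    using partial_eq_0 by (auto intro: ccontr)
  moreover have "finite ((\<lambda>(\<alpha>, J). Jet \<alpha> J) -` V)"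
    using V(1) by (intro finite_vimageI) (auto simp: inj_on_def)
  ultimately show ?thesis
    by (rule finite_subset)
qed

section \<open>Calculus rules for total derivatives\<close>

lemma total_deriv_add:
  assumes "jet_differentiable F" "jet_differentiable G"
  shows "total_deriv i (\<lambda>p. F p + G p) p = total_deriv i F p + total_deriv i G p"
  using Sum_any.distrib [OF finite_jet_support [OF assms(1), of p i] finite_jet_support [OF assms(2), of p i]]
  by (simp add: total_deriv_def partial_add assms case_prod_unfold algebra_simps)

lemma total_deriv_diff:
  assumes "jet_differentiable F" "jet_differentiable G"
  shows "total_deriv i (\<lambda>p. F p - G p) p = total_deriv i F p - total_deriv i G p"
  \<comment> \<open>Additivity is applied to the sum of \<open>F - G\<close> and
    \<open>G\<close>.\<close>
  using total_deriv_add [OF jet_differentiable_diff [OF assms] assms(2), of i p] by simp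

lemma total_deriv_mult:
  assumes "jet_differentiable F" "jet_differentiable G"
  shows "total_deriv i (\<lambda>p. F p * G p) p = total_deriv i F p * G p + F p * total_deriv i G p"
proof -
  let ?S = "\<lambda>F k. case k of (\<alpha>, J) \<Rightarrow> p (Jet \<alpha> (incr i J)) * partial (Jet \<alpha> J) F p"
  have fin: "finite {k. ?S F k \<noteq> 0}" "finite {k. ?S G k \<noteq> 0}"
    by (intro finite_jet_support assms)+
  have "Sum_any (?S (\<lambda>p. F p * G p)) = Sum_any (\<lambda>k. ?S F k * G p + F p * ?S G k)"
    by (rule Sum_any.cong) (auto simp: partial_mult assms algebra_simps)
  also have "\<dots> = Sum_any (\<lambda>k. ?S F k * G p) + Sum_any (\<lambda>k. F p * ?S G k)"
    by (intro Sum_any.distrib finite_subset [OF _ fin(1)] finite_subset [OF _ fin(2)]) auto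
  also have "\<dots> = Sum_any (?S F) * G p + F p * Sum_any (?S G)"
    by (simp add: Sum_any_left_distrib [OF fin(1)] Sum_any_right_distrib [OF fin(2)])
  finally show ?thesis
    by (simp add: total_deriv_def partial_mult assms algebra_simps)
qed

lemma total_deriv_coord: "total_deriv i (\<lambda>p. p (Jet \<alpha> J)) p = p (Jet \<alpha> (incr i J))"
proof -
  have "Sum_any (\<lambda>(\<beta>, K). p (Jet \<beta> (incr i K)) * partial (Jet \<beta> K) (\<lambda>p. p (Jet \<alpha> J)) p)
      = (\<Sum>(\<beta>, K)\<in>{(\<alpha>, J)}. p (Jet \<beta> (incr i K)) * partial (Jet \<beta> K) (\<lambda>p. p (Jet \<alpha> J)) p)"
    by (rule Sum_any.expand_superset) (auto simp: partial_coord split: if_splits)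
  then show ?thesis
    by (simp add: total_deriv_def partial_coord)
qed

text \<open>Only the coordinates of order 0 move the base point, so three terms of the sum over all
  jet coordinates survive.\<close>

lemma total_deriv_base_point:
  assumes g: "C_k (Suc k) g"
  shows "total_deriv i (\<lambda>p. g (base_point p)) p = pd (Base i) g (base_point p)
      + (p (Jet Dep_a (incr i (0, 0))) * pd a_0 g (base_point p)
       + p (Jet Dep_b (incr i (0, 0))) * pd b_0 g (base_point p)
       + p (Jet Dep_c (incr i (0, 0))) * pd c_0 g (base_point p))"
proof -
  have zero: "pd (Jet \<alpha> J) g (base_point p) = 0" if "J \<noteq> (0, 0)" for \<alpha> J
  proof -
    have "coord_dir (Jet \<alpha> J) = 0"
      using that by (cases "Jet \<alpha> J" rule: coord_dir.cases) auto
    then show ?thesis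
      using linear_0 [OF linear_frechet_derivative [OF C_k_differentiable [OF g]]] by (simp add: pd_def)
  qed
  have "Sum_any (\<lambda>(\<beta>, K). p (Jet \<beta> (incr i K)) * pd (Jet \<beta> K) g (base_point p))
      = (\<Sum>(\<beta>, K)\<in>{(Dep_a, (0, 0)), (Dep_b, (0, 0)), (Dep_c, (0, 0))}.
          p (Jet \<beta> (incr i K)) * pd (Jet \<beta> K) g (base_point p))"
  proof (rule Sum_any.expand_superset)
    show "{k. (case k of (\<beta>, K) \<Rightarrow> p (Jet \<beta> (incr i K)) * pd (Jet \<beta> K) g (base_point p)) \<noteq> 0}
        \<subseteq> {(Dep_a, (0, 0)), (Dep_b, (0, 0)), (Dep_c, (0, 0))}"
    proof (rule subsetI, unfold mem_Collect_eq)
      fix k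
      assume "(case k of (\<beta>, K) \<Rightarrow> p (Jet \<beta> (incr i K)) * pd (Jet \<beta> K) g (base_point p)) \<noteq> 0"
      then have "snd k = (0, 0)"
        using zero by (cases k) auto
      then show "k \<in> {(Dep_a, (0, 0)), (Dep_b, (0, 0)), (Dep_c, (0, 0))}"
        by (cases "fst k"; cases k) auto
    qed
  qed simp
  then show ?thesis
    by (simp add: total_deriv_def partial_base_point [OF g])
qed

section \<open>Explicit prolongation formulas\<close>

text \<open>Closed forms of the first and second total derivatives of a function of the base point.
  \<open>D2 i j\<close> results from applying the product rule to \<open>D1 j\<close>, with
  \<open>i\<close> as the outer derivative.\<close>

definition D1 :: "indep \<Rightarrow> (point \<Rightarrow> real) \<Rightarrow> jet \<Rightarrow> real" where
  "D1 i g p = pd (Base i) g (base_point p)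
      + (p (Jet Dep_a (incr i (0, 0))) * pd a_0 g (base_point p)
       + p (Jet Dep_b (incr i (0, 0))) * pd b_0 g (base_point p)
       + p (Jet Dep_c (incr i (0, 0))) * pd c_0 g (base_point p))"

definition D2 :: "indep \<Rightarrow> indep \<Rightarrow> (point \<Rightarrow> real) \<Rightarrow> jet \<Rightarrow> real" where
  "D2 i j g p = D1 i (pd (Base j) g) p
      + ((p (Jet Dep_a (incr i (incr j (0, 0)))) * pd a_0 g (base_point p)
          + p (Jet Dep_a (incr j (0, 0))) * D1 i (pd a_0 g) p)
       + (p (Jet Dep_b (incr i (incr j (0, 0)))) * pd b_0 g (base_point p)
          + p (Jet Dep_b (incr j (0, 0))) * D1 i (pd b_0 g) p)
       + (p (Jet Dep_c (incr i (incr j (0, 0)))) * pd c_0 g (base_point p)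
          + p (Jet Dep_c (incr j (0, 0))) * D1 i (pd c_0 g) p))"

lemma total_deriv_base_point_D1:
  "C_k (Suc k) g \<Longrightarrow> total_deriv i (\<lambda>p. g (base_point p)) = D1 i g"
  by (rule ext) (simp only: D1_def total_deriv_base_point)

lemma D1_fun:
  "D1 i g = (\<lambda>p. pd (Base i) g (base_point p)
      + (p (Jet Dep_a (incr i (0, 0))) * pd a_0 g (base_point p)
       + p (Jet Dep_b (incr i (0, 0))) * pd b_0 g (base_point p)
       + p (Jet Dep_c (incr i (0, 0))) * pd c_0 g (base_point p)))"
  by (simp add: fun_eq_iff D1_def)

lemma jet_differentiable_D1: "C_k (Suc (Suc k)) g \<Longrightarrow> jet_differentiable (D1 i g)"
  unfolding D1_fun
  by (intro jet_differentiable_add jet_differentiable_mult jet_differentiable_coord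
        jet_differentiable_base_point [OF C_k_pd])

lemma total_deriv_D1:
  assumes "C_k (Suc (Suc k)) g"
  shows "total_deriv i (D1 j g) p = D2 i j g p"
  unfolding D1_fun [of j]
  by (simp add: D2_def total_deriv_add total_deriv_mult total_deriv_coord
      total_deriv_base_point_D1 [OF C_k_pd [OF assms]]
      jet_differentiable_base_point [OF C_k_pd [OF assms]] del: incr.simps)

section \<open>Prolongation of a smooth field applied to the six equations\<close>

abbreviation delta1 :: "jet \<Rightarrow> real" where
  "delta1 p \<equiv> p a_xx - p b_tt"

abbreviation delta2 :: "jet \<Rightarrow> real" where
  "delta2 p \<equiv> p b_xt + p c_xx"

abbreviation delta3 :: "jet \<Rightarrow> real" where
  "delta3 p \<equiv> p a_xt + p c_tt"

abbreviation delta4 :: "jet \<Rightarrow> real" where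
  "delta4 p \<equiv> p a_x * p c_t + p a_t * p b_t - p a_t * p c_x - (p c_t)\<^sup>2
          + 2 * p c_0 * p a_xt + p b_0 * p a_tt - p a_0 * p c_xt"

abbreviation delta5 :: "jet \<Rightarrow> real" where
  "delta5 p \<equiv> p a_t * p b_x - p c_x * p c_t + p c_0 * p a_xx - p a_0 * p c_xx
          - p c_0 * p c_xt - p b_0 * p c_tt"

abbreviation delta6 :: "jet \<Rightarrow> real" where
  "delta6 p \<equiv> p a_x * p b_x - p b_x * p c_t + p b_t * p c_x - (p c_x)\<^sup>2
          + p a_0 * p b_xx + 2 * p c_0 * p b_xt - p b_0 * p c_xt"

lemma partial_const: "partial v (\<lambda>p. c) p = 0"
  by (rule partial_eqI) simp

lemma jet_differentiable_const [simp]: "jet_differentiable (\<lambda>p. c)"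
  by (auto simp: jet_differentiable_def)

locale vector_field =
  fixes X :: "point \<Rightarrow> point"
  assumes smooth: "smooth X"
begin

abbreviation \<xi> :: "point \<Rightarrow> real" where "\<xi> \<equiv> \<lambda>z. indep_comp Ind_x (X z)"
abbreviation \<tau> :: "point \<Rightarrow> real" where "\<tau> \<equiv> \<lambda>z. indep_comp Ind_t (X z)"
abbreviation \<phi> :: "dep \<Rightarrow> point \<Rightarrow> real" where "\<phi> \<alpha> \<equiv> \<lambda>z. dep_comp \<alpha> (X z)"

lemma C_k_components: "C_k k \<xi>" "C_k k \<tau>" "C_k k (\<phi> \<alpha>)"
proof -
  have X: "C_k k X"
    using smooth by (simp add: smooth_def)
  \<comment> \<open>Written as compositions of projections, the component functions are visibly
    bounded linear, so they preserve \<open>C_k\<close>.\<close>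
  have indep: "indep_comp Ind_x = fst" "indep_comp Ind_t = (\<lambda>z. fst (snd z))"
    and dep: "dep_comp Dep_a = (\<lambda>z. fst (snd (snd z)))" "dep_comp Dep_b = (\<lambda>z. fst (snd (snd (snd z))))"
      "dep_comp Dep_c = (\<lambda>z. snd (snd (snd (snd z))))"
    by auto
  have "bounded_linear (indep_comp i)" "bounded_linear (dep_comp \<alpha>)" for i \<alpha>
    by (cases i; cases \<alpha>; simp add: indep dep bounded_linear_fst bounded_linear_snd
          bounded_linear_fst_comp bounded_linear_snd_comp)+
  then show "C_k k \<xi>" "C_k k \<tau>" "C_k k (\<phi> \<alpha>)"
    using C_k_bounded_linear_comp X by blast+
qed

lemma characteristic_eq:
  "characteristic X \<alpha> =
     (\<lambda>p. \<phi> \<alpha> (base_point p) - (\<xi> (base_point p) * p (Jet \<alpha> (1, 0)) + \<tau> (base_point p) * p (Jet \<alpha> (0, 1))))"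
  by (simp add: fun_eq_iff characteristic_def UNIV_indep)

lemmas jet_differentiable_components =
  C_k_components [of "Suc 0", THEN jet_differentiable_base_point]

lemmas total_deriv_components =
  C_k_components [of "Suc 0", THEN total_deriv_base_point_D1]

lemma total_deriv_characteristic:
  "total_deriv i (characteristic X \<alpha>) =
     (\<lambda>p. D1 i (\<phi> \<alpha>) p - ((D1 i \<xi> p * p (Jet \<alpha> (1, 0)) + \<xi> (base_point p) * p (Jet \<alpha> (incr i (1, 0))))
          + (D1 i \<tau> p * p (Jet \<alpha> (0, 1)) + \<tau> (base_point p) * p (Jet \<alpha> (incr i (0, 1))))))"
  unfolding characteristic_eq fun_eq_iff
  by (simp add: total_deriv_diff total_deriv_add total_deriv_mult total_deriv_coord
      jet_differentiable_components total_deriv_components del: incr.simps)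

lemma total_deriv2_characteristic:
  "total_deriv i (total_deriv j (characteristic X \<alpha>)) p =
     D2 i j (\<phi> \<alpha>) p
      - ((D2 i j \<xi> p * p (Jet \<alpha> (1, 0)) + D1 j \<xi> p * p (Jet \<alpha> (incr i (1, 0)))
          + (D1 i \<xi> p * p (Jet \<alpha> (incr j (1, 0))) + \<xi> (base_point p) * p (Jet \<alpha> (incr i (incr j (1, 0))))))
       + (D2 i j \<tau> p * p (Jet \<alpha> (0, 1)) + D1 j \<tau> p * p (Jet \<alpha> (incr i (0, 1)))
          + (D1 i \<tau> p * p (Jet \<alpha> (incr j (0, 1))) + \<tau> (base_point p) * p (Jet \<alpha> (incr i (incr j (0, 1)))))))"
  unfolding total_deriv_characteristic
  by (simp add: total_deriv_diff total_deriv_add total_deriv_mult total_deriv_coord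
      jet_differentiable_components total_deriv_components
      jet_differentiable_D1 [OF C_k_components(1)] jet_differentiable_D1 [OF C_k_components(2)]
      jet_differentiable_D1 [OF C_k_components(3)] total_deriv_D1 [OF C_k_components(1)]
      total_deriv_D1 [OF C_k_components(2)] total_deriv_D1 [OF C_k_components(3)] del: incr.simps)

text \<open>These are the prolongation coefficients after cancellation: the products of
  \<open>\<xi>\<close> and \<open>\<tau>\<close> with coordinates one order higher, present in the
  derivatives of the characteristic, are removed by the sum added in
  \<open>prolong_coeff\<close>.\<close>

definition coeff1 :: "indep \<Rightarrow> dep \<Rightarrow> jet \<Rightarrow> real" where
  "coeff1 i \<alpha> p = D1 i (\<phi> \<alpha>) p - D1 i \<xi> p * p (Jet \<alpha> (1, 0)) - D1 i \<tau> p * p (Jet \<alpha> (0, 1))"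

definition coeff2 :: "indep \<Rightarrow> indep \<Rightarrow> dep \<Rightarrow> jet \<Rightarrow> real" where
  "coeff2 i j \<alpha> p = D2 i j (\<phi> \<alpha>) p - D2 i j \<xi> p * p (Jet \<alpha> (1, 0)) - D2 i j \<tau> p * p (Jet \<alpha> (0, 1))
     - D1 i \<xi> p * p (Jet \<alpha> (incr j (1, 0))) - D1 i \<tau> p * p (Jet \<alpha> (incr j (0, 1)))
     - D1 j \<xi> p * p (Jet \<alpha> (incr i (1, 0))) - D1 j \<tau> p * p (Jet \<alpha> (incr i (0, 1)))"

lemma prolong_coeff_eq:
  "prolong_coeff X \<alpha> (1, 0) p = coeff1 Ind_x \<alpha> p"
  "prolong_coeff X \<alpha> (0, 1) p = coeff1 Ind_t \<alpha> p"
  "prolong_coeff X \<alpha> (2, 0) p = coeff2 Ind_x Ind_x \<alpha> p"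
  "prolong_coeff X \<alpha> (1, 1) p = coeff2 Ind_x Ind_t \<alpha> p"
  "prolong_coeff X \<alpha> (0, 2) p = coeff2 Ind_t Ind_t \<alpha> p"
  by (simp_all add: prolong_coeff_def coeff1_def coeff2_def UNIV_indep numeral_2_eq_2
      total_deriv2_characteristic) (simp_all add: total_deriv_characteristic)

lemma multi_indices_up_to_2:
  "{J. 1 \<le> fst J + snd J \<and> fst J + snd J \<le> 2} = {(1, 0), (0, 1), (2, 0), (1, 1), (0, 2::nat)}"
  by (auto simp: prod_eq_iff)

lemma prolong2_eq:
  "prolong2 X F p =
     \<xi> (base_point p) * partial (Base Ind_x) F p + \<tau> (base_point p) * partial (Base Ind_t) F p
   + (\<phi> Dep_a (base_point p) * partial a_0 F p + \<phi> Dep_b (base_point p) * partial b_0 F p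
      + \<phi> Dep_c (base_point p) * partial c_0 F p)
   + ((coeff1 Ind_x Dep_a p * partial a_x F p + coeff1 Ind_t Dep_a p * partial a_t F p
       + coeff2 Ind_x Ind_x Dep_a p * partial a_xx F p + coeff2 Ind_x Ind_t Dep_a p * partial a_xt F p
       + coeff2 Ind_t Ind_t Dep_a p * partial a_tt F p)
    + (coeff1 Ind_x Dep_b p * partial b_x F p + coeff1 Ind_t Dep_b p * partial b_t F p
       + coeff2 Ind_x Ind_x Dep_b p * partial b_xx F p + coeff2 Ind_x Ind_t Dep_b p * partial b_xt F p
       + coeff2 Ind_t Ind_t Dep_b p * partial b_tt F p)
    + (coeff1 Ind_x Dep_c p * partial c_x F p + coeff1 Ind_t Dep_c p * partial c_t F p
       + coeff2 Ind_x Ind_x Dep_c p * partial c_xx F p + coeff2 Ind_x Ind_t Dep_c p * partial c_xt F p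
       + coeff2 Ind_t Ind_t Dep_c p * partial c_tt F p))"
  unfolding prolong2_def multi_indices_up_to_2
  by (simp add: UNIV_indep UNIV_dep prolong_coeff_eq [simplified])

lemmas prolong2_simps = prolong2_eq partial_add partial_diff partial_mult partial_const partial_coord
  power2_eq_square

text \<open>\<open>E1\<close> to \<open>E6\<close> are the linearised left-hand sides, with
  prolongation coefficients in place of the variations of the derivatives;
  \<open>prolong2_walker_einstein_system\<close> identifies them with the prolonged field applied to
  \<open>delta1\<close> to \<open>delta6\<close>.\<close>

definition E1 :: "jet \<Rightarrow> real" where
  "E1 p = coeff2 Ind_x Ind_x Dep_a p - coeff2 Ind_t Ind_t Dep_b p"

definition E2 :: "jet \<Rightarrow> real" where
  "E2 p = coeff2 Ind_x Ind_t Dep_b p + coeff2 Ind_x Ind_x Dep_c p"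

definition E3 :: "jet \<Rightarrow> real" where
  "E3 p = coeff2 Ind_x Ind_t Dep_a p + coeff2 Ind_t Ind_t Dep_c p"

definition E4 :: "jet \<Rightarrow> real" where
  "E4 p = coeff1 Ind_x Dep_a p * p c_t + p a_x * coeff1 Ind_t Dep_c p
     + coeff1 Ind_t Dep_a p * p b_t + p a_t * coeff1 Ind_t Dep_b p
     - coeff1 Ind_t Dep_a p * p c_x - p a_t * coeff1 Ind_x Dep_c p - 2 * p c_t * coeff1 Ind_t Dep_c p
     + 2 * \<phi> Dep_c (base_point p) * p a_xt + 2 * p c_0 * coeff2 Ind_x Ind_t Dep_a p
     + \<phi> Dep_b (base_point p) * p a_tt + p b_0 * coeff2 Ind_t Ind_t Dep_a p
     - \<phi> Dep_a (base_point p) * p c_xt - p a_0 * coeff2 Ind_x Ind_t Dep_c p"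

definition E5 :: "jet \<Rightarrow> real" where
  "E5 p = coeff1 Ind_t Dep_a p * p b_x + p a_t * coeff1 Ind_x Dep_b p
     - coeff1 Ind_x Dep_c p * p c_t - p c_x * coeff1 Ind_t Dep_c p
     + \<phi> Dep_c (base_point p) * p a_xx + p c_0 * coeff2 Ind_x Ind_x Dep_a p
     - \<phi> Dep_a (base_point p) * p c_xx - p a_0 * coeff2 Ind_x Ind_x Dep_c p
     - \<phi> Dep_c (base_point p) * p c_xt - p c_0 * coeff2 Ind_x Ind_t Dep_c p
     - \<phi> Dep_b (base_point p) * p c_tt - p b_0 * coeff2 Ind_t Ind_t Dep_c p"

definition E6 :: "jet \<Rightarrow> real" where
  "E6 p = coeff1 Ind_x Dep_a p * p b_x + p a_x * coeff1 Ind_x Dep_b p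
     - coeff1 Ind_x Dep_b p * p c_t - p b_x * coeff1 Ind_t Dep_c p
     + coeff1 Ind_t Dep_b p * p c_x + p b_t * coeff1 Ind_x Dep_c p - 2 * p c_x * coeff1 Ind_x Dep_c p
     + \<phi> Dep_a (base_point p) * p b_xx + p a_0 * coeff2 Ind_x Ind_x Dep_b p
     + 2 * \<phi> Dep_c (base_point p) * p b_xt + 2 * p c_0 * coeff2 Ind_x Ind_t Dep_b p
     - \<phi> Dep_b (base_point p) * p c_xt - p b_0 * coeff2 Ind_x Ind_t Dep_c p"

lemma prolong2_walker_einstein_system:
  "prolong2 X delta1 p = E1 p"
  "prolong2 X delta2 p = E2 p"
  "prolong2 X delta3 p = E3 p"
  "prolong2 X delta4 p = E4 p"
  "prolong2 X delta5 p = E5 p"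
  "prolong2 X delta6 p = E6 p"
  by (simp_all add: prolong2_simps E1_def E2_def E3_def E4_def E5_def E6_def algebra_simps)

end

section \<open>Determining equations\<close>

abbreviation "d_x \<equiv> pd (Base Ind_x)"
abbreviation "d_t \<equiv> pd (Base Ind_t)"
abbreviation "d_a \<equiv> pd a_0"
abbreviation "d_b \<equiv> pd b_0"
abbreviation "d_c \<equiv> pd c_0"

text \<open>Overwriting the coordinates of order 0 allows the base point and the derivatives to be
  prescribed independently.\<close>

definition mk_jet :: "point \<Rightarrow> jet \<Rightarrow> jet" where
  "mk_jet z f = f(Base Ind_x := indep_comp Ind_x z, Base Ind_t := indep_comp Ind_t z,
     a_0 := dep_comp Dep_a z, b_0 := dep_comp Dep_b z, c_0 := dep_comp Dep_c z)"

lemma base_point_mk_jet [simp]: "base_point (mk_jet z f) = z"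
  by (cases z) (simp add: base_point_def mk_jet_def)

lemma mk_jet_simps [simp]:
  "mk_jet z f a_0 = dep_comp Dep_a z"
  "mk_jet z f b_0 = dep_comp Dep_b z"
  "mk_jet z f c_0 = dep_comp Dep_c z"
  "mk_jet z f (Jet \<alpha> (Suc m, n)) = f (Jet \<alpha> (Suc m, n))"
  "mk_jet z f (Jet \<alpha> (m, Suc n)) = f (Jet \<alpha> (m, Suc n))"
  "mk_jet z f (Jet \<alpha> (numeral k, n)) = f (Jet \<alpha> (numeral k, n))"
  "mk_jet z f (Jet \<alpha> (m, numeral k)) = f (Jet \<alpha> (m, numeral k))"
  by (simp_all add: mk_jet_def)

text \<open>A polynomial of degree 3 in two variables is determined by its values at these ten points.\<close>

lemma cubic_grid:
  fixes P :: "real \<Rightarrow> real \<Rightarrow> bool"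
  assumes "\<And>u v. P u v"
  shows "P 0 0" "P 1 0" "P (- 1) 0" "P 2 0" "P 0 1" "P 0 (- 1)" "P 0 2" "P 1 1" "P 1 (- 1)" "P (- 1) 1"
  by (rule assms)+

section \<open>Relations forced by the linear equations\<close>

locale walker_symmetry = vector_field +
  assumes invariance: "\<And>\<Delta> p. \<lbrakk>\<Delta> \<in> walker_einstein_system; \<forall>\<Delta>'\<in>walker_einstein_system. \<Delta>' p = 0\<rbrakk>
    \<Longrightarrow> prolong2 X \<Delta> p = 0"
begin

lemma E_eq_0:
  assumes "delta1 p = 0" "delta2 p = 0" "delta3 p = 0" "delta4 p = 0" "delta5 p = 0" "delta6 p = 0"
  shows "E1 p = 0" "E2 p = 0" "E3 p = 0" "E4 p = 0" "E5 p = 0" "E6 p = 0"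
proof -
  have "\<forall>\<Delta>\<in>walker_einstein_system. \<Delta> p = 0"
    unfolding walker_einstein_system_def using assms by blast
  then show "E1 p = 0" "E2 p = 0" "E3 p = 0" "E4 p = 0" "E5 p = 0" "E6 p = 0"
    using invariance [of _ p]
    unfolding walker_einstein_system_def prolong2_walker_einstein_system [symmetric] by blast+
qed

definition first_jet :: "point \<Rightarrow> real \<Rightarrow> real \<Rightarrow> real \<Rightarrow> real \<Rightarrow> real \<Rightarrow> real \<Rightarrow> jet" where
  "first_jet z a1 a2 b1 b2 c1 c2 =
     mk_jet z ((\<lambda>_. 0)(a_x := a1, a_t := a2, b_x := b1, b_t := b2, c_x := c1, c_t := c2))"

text \<open>Without second derivatives the three linear equations hold trivially and every term with
  an undifferentiated \<open>a\<close>, \<open>b\<close> or \<open>c\<close> drops out. The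
  hypotheses are what remains, and they do not involve \<open>z\<close>.\<close>

lemma E_first_jet:
  assumes "a1 * c2 + a2 * b2 - a2 * c1 - c2 * c2 = 0" "a2 * b1 - c1 * c2 = 0"
    "a1 * b1 - b1 * c2 + b2 * c1 - c1 * c1 = 0"
  shows "E1 (first_jet z a1 a2 b1 b2 c1 c2) = 0" "E2 (first_jet z a1 a2 b1 b2 c1 c2) = 0"
    "E3 (first_jet z a1 a2 b1 b2 c1 c2) = 0" "E4 (first_jet z a1 a2 b1 b2 c1 c2) = 0"
    "E5 (first_jet z a1 a2 b1 b2 c1 c2) = 0" "E6 (first_jet z a1 a2 b1 b2 c1 c2) = 0"
  using assms by (intro E_eq_0; simp add: first_jet_def power2_eq_square numeral_2_eq_2)+

lemmas D_commute = C_k_components(1) [THEN pd_commute] C_k_components(2) [THEN pd_commute] C_k_components(3) [THEN pd_commute]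

text \<open>As rewrite rules these sort iterated derivatives into the order x, t, a, b, c, outermost
  first, so that each mixed derivative appears as a single unknown.\<close>

lemmas mixed = D_commute [of "Base Ind_t" "Base Ind_x"]
  D_commute [of a_0 "Base Ind_x"] D_commute [of a_0 "Base Ind_t"]
  D_commute [of b_0 "Base Ind_x"] D_commute [of b_0 "Base Ind_t"] D_commute [of b_0 a_0]
  D_commute [of c_0 "Base Ind_x"] D_commute [of c_0 "Base Ind_t"] D_commute [of c_0 a_0] D_commute [of c_0 b_0]

lemmas expand = coeff1_def coeff2_def D1_def D2_def first_jet_def mixed

text \<open>
  The names list the coordinates on which the parameters \<open>u, v\<close> are placed: \<open>act_bt\<close> stands for
  \<open>a_x = c_t = u\<close>, \<open>b_t = v\<close>, the other derivatives being zero.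
\<close>

lemma linear_part_act_bt:
  shows "2 * d_x (d_a (\<phi> Dep_a)) z - d_x (d_x \<xi>) z - 2 * d_t (d_c (\<phi> Dep_b)) z = 0"
      "- 2 * d_t (d_b (\<phi> Dep_b)) z + d_t (d_t \<tau>) z = 0"
      "d_a (d_a (\<phi> Dep_a)) z - 2 * d_x (d_a \<xi>) z - d_c (d_c (\<phi> Dep_b)) z = 0"
      "- 2 * d_b (d_c (\<phi> Dep_b)) z + 2 * d_t (d_c \<tau>) z = 0"
      "- d_b (d_b (\<phi> Dep_b)) z + 2 * d_t (d_b \<tau>) z = 0"
      "d_a (d_a \<xi>) z = 0"
      "d_c (d_c \<tau>) z = 0"
      "d_b (d_c \<tau>) z = 0"
      "d_b (d_b \<tau>) z = 0"
    and "d_x (d_b (\<phi> Dep_b)) z - d_x (d_t \<tau>) z = 0"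
      "d_a (d_b (\<phi> Dep_b)) z - d_t (d_a \<tau>) z - d_x (d_c \<tau>) z = 0"
      "d_x (d_b \<tau>) z = 0"
      "d_a (d_a \<tau>) z = 0"
      "d_a (d_c \<tau>) z = 0"
      "d_a (d_b \<tau>) z = 0"
    and "d_t (d_a (\<phi> Dep_a)) z + d_x (d_c (\<phi> Dep_a)) z - d_x (d_t \<xi>) z + 2 * d_t (d_c (\<phi> Dep_c)) z - d_t (d_t \<tau>) z = 0"
      "d_a (d_c (\<phi> Dep_a)) z - d_t (d_a \<xi>) z - d_x (d_c \<xi>) z - 2 * d_t (d_c \<tau>) z + d_c (d_c (\<phi> Dep_c)) z = 0"
      "d_a (d_b (\<phi> Dep_a)) z - d_x (d_b \<xi>) z - 2 * d_t (d_b \<tau>) z + 2 * d_b (d_c (\<phi> Dep_c)) z = 0"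
      "d_b (d_b (\<phi> Dep_c)) z = 0"
      "- d_a (d_c \<xi>) z - d_c (d_c \<tau>) z = 0"
      "- d_a (d_b \<xi>) z - 2 * d_b (d_c \<tau>) z = 0"
proof -
  have E: "E1 (first_jet z u 0 0 v 0 u) = 0" "E2 (first_jet z u 0 0 v 0 u) = 0" "E3 (first_jet z u 0 0 v 0 u) = 0" for u v
    by (rule E_first_jet; simp)+
  \<comment> \<open>The ten evaluations are linear equations in the unknown derivatives at
    \<open>z\<close>. Each coefficient of the cubic is a linear combination of them, so linear
    arithmetic extracts the relations.\<close>
  note G = cubic_grid [where P = "\<lambda>u v. E1 (first_jet z u 0 0 v 0 u) = 0", OF E(1), unfolded E1_def expand, simplified]
  show "2 * d_x (d_a (\<phi> Dep_a)) z - d_x (d_x \<xi>) z - 2 * d_t (d_c (\<phi> Dep_b)) z = 0"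
      "- 2 * d_t (d_b (\<phi> Dep_b)) z + d_t (d_t \<tau>) z = 0"
      "d_a (d_a (\<phi> Dep_a)) z - 2 * d_x (d_a \<xi>) z - d_c (d_c (\<phi> Dep_b)) z = 0"
      "- 2 * d_b (d_c (\<phi> Dep_b)) z + 2 * d_t (d_c \<tau>) z = 0"
      "- d_b (d_b (\<phi> Dep_b)) z + 2 * d_t (d_b \<tau>) z = 0"
      "d_a (d_a \<xi>) z = 0"
      "d_c (d_c \<tau>) z = 0"
      "d_b (d_c \<tau>) z = 0"
      "d_b (d_b \<tau>) z = 0"
    using G by linarith+
  note G = cubic_grid [where P = "\<lambda>u v. E2 (first_jet z u 0 0 v 0 u) = 0", OF E(2), unfolded E2_def expand, simplified]
  show "d_x (d_b (\<phi> Dep_b)) z - d_x (d_t \<tau>) z = 0"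
      "d_a (d_b (\<phi> Dep_b)) z - d_t (d_a \<tau>) z - d_x (d_c \<tau>) z = 0"
      "d_x (d_b \<tau>) z = 0"
      "d_a (d_a \<tau>) z = 0"
      "d_a (d_c \<tau>) z = 0"
      "d_a (d_b \<tau>) z = 0"
    using G by linarith+
  note G = cubic_grid [where P = "\<lambda>u v. E3 (first_jet z u 0 0 v 0 u) = 0", OF E(3), unfolded E3_def expand, simplified]
  show "d_t (d_a (\<phi> Dep_a)) z + d_x (d_c (\<phi> Dep_a)) z - d_x (d_t \<xi>) z + 2 * d_t (d_c (\<phi> Dep_c)) z - d_t (d_t \<tau>) z = 0"
      "d_a (d_c (\<phi> Dep_a)) z - d_t (d_a \<xi>) z - d_x (d_c \<xi>) z - 2 * d_t (d_c \<tau>) z + d_c (d_c (\<phi> Dep_c)) z = 0"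
      "d_a (d_b (\<phi> Dep_a)) z - d_x (d_b \<xi>) z - 2 * d_t (d_b \<tau>) z + 2 * d_b (d_c (\<phi> Dep_c)) z = 0"
      "d_b (d_b (\<phi> Dep_c)) z = 0"
      "- d_a (d_c \<xi>) z - d_c (d_c \<tau>) z = 0"
      "- d_a (d_b \<xi>) z - 2 * d_b (d_c \<tau>) z = 0"
    using G by linarith+
qed

text \<open>Interchanging x with t and a with b preserves the solution set of the system and carries
  the plane of \<open>linear_part_act_bt\<close> to the one used here.\<close>

lemma linear_part_ax_bct:
  shows "2 * d_x (d_a (\<phi> Dep_a)) z - d_x (d_x \<xi>) z = 0"
      "2 * d_x (d_c (\<phi> Dep_a)) z - 2 * d_t (d_b (\<phi> Dep_b)) z + d_t (d_t \<tau>) z = 0"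
      "d_a (d_a (\<phi> Dep_a)) z - 2 * d_x (d_a \<xi>) z = 0"
      "2 * d_a (d_c (\<phi> Dep_a)) z - 2 * d_x (d_c \<xi>) z = 0"
      "d_c (d_c \<xi>) z = 0"
    and "d_x (d_b (\<phi> Dep_b)) z + d_t (d_c (\<phi> Dep_b)) z - d_x (d_t \<tau>) z + 2 * d_x (d_c (\<phi> Dep_c)) z - d_x (d_x \<xi>) z = 0"
      "d_a (d_a (\<phi> Dep_c)) z = 0"
      "d_a (d_b (\<phi> Dep_b)) z - 2 * d_x (d_a \<xi>) z - d_t (d_a \<tau>) z + 2 * d_a (d_c (\<phi> Dep_c)) z = 0"
    and "d_t (d_a (\<phi> Dep_a)) z - d_x (d_t \<xi>) z = 0"
      "d_t (d_a \<xi>) z = 0"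
      "d_a (d_b (\<phi> Dep_a)) z - d_x (d_b \<xi>) z - d_t (d_c \<xi>) z = 0"
      "d_b (d_c \<xi>) z = 0"
      "d_b (d_b \<xi>) z = 0"
proof -
  have E: "E1 (first_jet z u 0 0 v v 0) = 0" "E2 (first_jet z u 0 0 v v 0) = 0" "E3 (first_jet z u 0 0 v v 0) = 0" for u v
    by (rule E_first_jet; simp)+
  note G = cubic_grid [where P = "\<lambda>u v. E1 (first_jet z u 0 0 v v 0) = 0", OF E(1), unfolded E1_def expand, simplified]
  show "2 * d_x (d_a (\<phi> Dep_a)) z - d_x (d_x \<xi>) z = 0"
      "2 * d_x (d_c (\<phi> Dep_a)) z - 2 * d_t (d_b (\<phi> Dep_b)) z + d_t (d_t \<tau>) z = 0"
      "d_a (d_a (\<phi> Dep_a)) z - 2 * d_x (d_a \<xi>) z = 0"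
      "2 * d_a (d_c (\<phi> Dep_a)) z - 2 * d_x (d_c \<xi>) z = 0"
      "d_c (d_c \<xi>) z = 0"
    using G by linarith+
  note G = cubic_grid [where P = "\<lambda>u v. E2 (first_jet z u 0 0 v v 0) = 0", OF E(2), unfolded E2_def expand, simplified]
  show "d_x (d_b (\<phi> Dep_b)) z + d_t (d_c (\<phi> Dep_b)) z - d_x (d_t \<tau>) z + 2 * d_x (d_c (\<phi> Dep_c)) z - d_x (d_x \<xi>) z = 0"
      "d_a (d_a (\<phi> Dep_c)) z = 0"
      "d_a (d_b (\<phi> Dep_b)) z - 2 * d_x (d_a \<xi>) z - d_t (d_a \<tau>) z + 2 * d_a (d_c (\<phi> Dep_c)) z = 0"
    using G by linarith+
  note G = cubic_grid [where P = "\<lambda>u v. E3 (first_jet z u 0 0 v v 0) = 0", OF E(3), unfolded E3_def expand, simplified]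
  show "d_t (d_a (\<phi> Dep_a)) z - d_x (d_t \<xi>) z = 0"
      "d_t (d_a \<xi>) z = 0"
      "d_a (d_b (\<phi> Dep_a)) z - d_x (d_b \<xi>) z - d_t (d_c \<xi>) z = 0"
      "d_b (d_c \<xi>) z = 0"
      "d_b (d_b \<xi>) z = 0"
    using G by linarith+
qed

text \<open>A third plane, \<open>a_x = c_t = u\<close>, \<open>b_x = v\<close>: the terms with
  \<open>b_x\<close> in the sixth equation cancel because \<open>a_x = c_t\<close>.\<close>

lemma linear_part_act_bx:
  shows "2 * d_x (d_b (\<phi> Dep_a)) z + d_t (d_t \<xi>) z = 0"
      "2 * d_a (d_b (\<phi> Dep_a)) z - 2 * d_x (d_b \<xi>) z + 2 * d_t (d_c \<xi>) z = 0"
      "d_b (d_b (\<phi> Dep_a)) z = 0"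
    and "d_t (d_b (\<phi> Dep_b)) z - d_x (d_t \<xi>) z + 2 * d_x (d_b (\<phi> Dep_c)) z = 0"
      "d_b (d_c (\<phi> Dep_b)) z - d_t (d_a \<xi>) z - d_x (d_c \<xi>) z - 2 * d_x (d_b \<tau>) z + 2 * d_a (d_b (\<phi> Dep_c)) z = 0"
    and "d_b (d_c (\<phi> Dep_a)) z - d_t (d_b \<xi>) z = 0"
proof -
  have E: "E1 (first_jet z u 0 v 0 0 u) = 0" "E2 (first_jet z u 0 v 0 0 u) = 0" "E3 (first_jet z u 0 v 0 0 u) = 0" for u v
    by (rule E_first_jet; simp)+
  note G = cubic_grid [where P = "\<lambda>u v. E1 (first_jet z u 0 v 0 0 u) = 0", OF E(1), unfolded E1_def expand, simplified]
  show "2 * d_x (d_b (\<phi> Dep_a)) z + d_t (d_t \<xi>) z = 0"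
      "2 * d_a (d_b (\<phi> Dep_a)) z - 2 * d_x (d_b \<xi>) z + 2 * d_t (d_c \<xi>) z = 0"
      "d_b (d_b (\<phi> Dep_a)) z = 0"
    using G by linarith+
  note G = cubic_grid [where P = "\<lambda>u v. E2 (first_jet z u 0 v 0 0 u) = 0", OF E(2), unfolded E2_def expand, simplified]
  show "d_t (d_b (\<phi> Dep_b)) z - d_x (d_t \<xi>) z + 2 * d_x (d_b (\<phi> Dep_c)) z = 0"
      "d_b (d_c (\<phi> Dep_b)) z - d_t (d_a \<xi>) z - d_x (d_c \<xi>) z - 2 * d_x (d_b \<tau>) z + 2 * d_a (d_b (\<phi> Dep_c)) z = 0"
    using G by linarith+
  note G = cubic_grid [where P = "\<lambda>u v. E3 (first_jet z u 0 v 0 0 u) = 0", OF E(3), unfolded E3_def expand, simplified]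
  show "d_b (d_c (\<phi> Dep_a)) z - d_t (d_b \<xi>) z = 0"
    using G by linarith+
qed

text \<open>The plane \<open>b_t = c_x = u\<close>, \<open>a_t = v\<close> is the image of the
  previous one under the same interchange.\<close>

lemma linear_part_bct_at:
  shows "- d_x (d_x \<tau>) z - 2 * d_t (d_a (\<phi> Dep_b)) z = 0"
      "d_c (d_c (\<phi> Dep_a)) z - d_b (d_b (\<phi> Dep_b)) z + 2 * d_t (d_b \<tau>) z = 0"
      "- 2 * d_x (d_c \<tau>) z - 2 * d_a (d_b (\<phi> Dep_b)) z + 2 * d_t (d_a \<tau>) z = 0"
      "d_a (d_a (\<phi> Dep_b)) z = 0"
    and "d_a (d_c (\<phi> Dep_b)) z - d_x (d_a \<tau>) z = 0"
    and "d_x (d_a (\<phi> Dep_a)) z - d_x (d_t \<tau>) z + 2 * d_t (d_a (\<phi> Dep_c)) z = 0"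
proof -
  have E: "E1 (first_jet z 0 v 0 u u 0) = 0" "E2 (first_jet z 0 v 0 u u 0) = 0" "E3 (first_jet z 0 v 0 u u 0) = 0" for u v
    by (rule E_first_jet; simp)+
  note G = cubic_grid [where P = "\<lambda>u v. E1 (first_jet z 0 v 0 u u 0) = 0", OF E(1), unfolded E1_def expand, simplified]
  show "- d_x (d_x \<tau>) z - 2 * d_t (d_a (\<phi> Dep_b)) z = 0"
      "d_c (d_c (\<phi> Dep_a)) z - d_b (d_b (\<phi> Dep_b)) z + 2 * d_t (d_b \<tau>) z = 0"
      "- 2 * d_x (d_c \<tau>) z - 2 * d_a (d_b (\<phi> Dep_b)) z + 2 * d_t (d_a \<tau>) z = 0"
      "d_a (d_a (\<phi> Dep_b)) z = 0"
    using G by linarith+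
  note G = cubic_grid [where P = "\<lambda>u v. E2 (first_jet z 0 v 0 u u 0) = 0", OF E(2), unfolded E2_def expand, simplified]
  show "d_a (d_c (\<phi> Dep_b)) z - d_x (d_a \<tau>) z = 0"
    using G by linarith+
  note G = cubic_grid [where P = "\<lambda>u v. E3 (first_jet z 0 v 0 u u 0) = 0", OF E(3), unfolded E3_def expand, simplified]
  show "d_x (d_a (\<phi> Dep_a)) z - d_x (d_t \<tau>) z + 2 * d_t (d_a (\<phi> Dep_c)) z = 0"
    using G by linarith+
qed

end

section \<open>Relations forced by the cubic and quadratic parts of the nonlinear equations\<close>

context walker_symmetry
begin

text \<open>At a \<open>first_jet\<close> the cubic terms of \<open>coeff2\<close> carry precisely
  such second derivatives. With these gone, the cubic parts of \<open>E4\<close>, \<open>E5\<close>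
  and \<open>E6\<close> involve only first derivatives of \<open>\<xi>\<close> and
  \<open>\<tau>\<close>.\<close>

lemma base_coefficients_vertical:
  shows "d_a (d_a \<xi>) z = 0" "d_a (d_b \<xi>) z = 0" "d_a (d_c \<xi>) z = 0"
    "d_b (d_b \<xi>) z = 0" "d_b (d_c \<xi>) z = 0" "d_c (d_c \<xi>) z = 0"
    and "d_a (d_a \<tau>) z = 0" "d_a (d_b \<tau>) z = 0" "d_a (d_c \<tau>) z = 0"
    "d_b (d_b \<tau>) z = 0" "d_b (d_c \<tau>) z = 0" "d_c (d_c \<tau>) z = 0"
  using linear_part_act_bt [of z] linear_part_ax_bct [of z] by simp_all

lemma nonlinear_part_cubic:
  shows "d_b \<xi> z = 0" "d_a \<tau> z = 0" "d_a \<xi> z = d_c \<tau> z" "d_c \<xi> z = d_b \<tau> z"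
proof -
  have E: "E4 (first_jet z u 0 0 v 0 u) = 0" "E5 (first_jet z u 0 0 v 0 u) = 0" for u v
    by (rule E_first_jet; simp)+
  note G = cubic_grid [where P = "\<lambda>u v. E4 (first_jet z u 0 0 v 0 u) = 0", OF E(1),
      unfolded E4_def expand base_coefficients_vertical, simplified, simplified algebra_simps]
  \<comment> \<open>These are, in order, the coefficients of \<open>u * v * v\<close>,
    \<open>u * u * u\<close> and \<open>u * u * v\<close>.\<close>
  show "d_b \<xi> z = 0" "d_a \<xi> z = d_c \<tau> z" "d_c \<xi> z = d_b \<tau> z"
    using G by linarith+
  note G = cubic_grid [where P = "\<lambda>u v. E5 (first_jet z u 0 0 v 0 u) = 0", OF E(2),
      unfolded E5_def expand base_coefficients_vertical, simplified, simplified algebra_simps]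
  show "d_a \<tau> z = 0"
    \<comment> \<open>In \<open>E5\<close> the cubic part on this plane is
      \<open>d_a \<tau> z\<close> times \<open>u * u * u\<close>.\<close>
    using G by linarith+
qed

text \<open>The cubic relations hold at every point, so they are identities of functions and may be
  differentiated.\<close>

lemma pd_nonlinear_part_cubic:
  shows "pd v (d_b \<xi>) z = 0" "pd v (d_a \<tau>) z = 0"
    "pd v (d_a \<xi>) z = pd v (d_c \<tau>) z" "pd v (d_c \<xi>) z = pd v (d_b \<tau>) z"
proof -
  have "d_b \<xi> = (\<lambda>z. 0)" "d_a \<tau> = (\<lambda>z. 0)" "d_a \<xi> = d_c \<tau>" "d_c \<xi> = d_b \<tau>"
    using nonlinear_part_cubic by auto
  then show "pd v (d_b \<xi>) z = 0" "pd v (d_a \<tau>) z = 0"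
    "pd v (d_a \<xi>) z = pd v (d_c \<tau>) z" "pd v (d_c \<xi>) z = pd v (d_b \<tau>) z"
    by simp_all
qed

text \<open>The differentiated cubic relations exchange derivatives of \<open>\<xi>\<close> and
  \<open>\<tau>\<close>, which settles the base coefficients; the linear parts then make every
  \<open>\<phi> \<alpha>\<close> affine along the fibres. This clears second derivatives from the
  quadratic parts of \<open>E4\<close>, \<open>E5\<close> and \<open>E6\<close>.\<close>

lemma second_order_vertical:
  shows "d_x (d_a \<xi>) z = 0" "d_x (d_b \<xi>) z = 0" "d_x (d_c \<xi>) z = 0"
    "d_t (d_a \<xi>) z = 0" "d_t (d_b \<xi>) z = 0" "d_t (d_c \<xi>) z = 0"
    and "d_x (d_a \<tau>) z = 0" "d_x (d_b \<tau>) z = 0" "d_x (d_c \<tau>) z = 0"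
    "d_t (d_a \<tau>) z = 0" "d_t (d_b \<tau>) z = 0" "d_t (d_c \<tau>) z = 0"
    and "d_a (d_a (\<phi> \<alpha>)) z = 0" "d_a (d_b (\<phi> \<alpha>)) z = 0" "d_a (d_c (\<phi> \<alpha>)) z = 0"
    "d_b (d_b (\<phi> \<alpha>)) z = 0" "d_b (d_c (\<phi> \<alpha>)) z = 0" "d_c (d_c (\<phi> \<alpha>)) z = 0"
proof -
  note \<xi>_b = pd_nonlinear_part_cubic(1) [of _ z] and \<tau>_a = pd_nonlinear_part_cubic(2) [of _ z]
    and \<xi>_a = pd_nonlinear_part_cubic(3) [of _ z] and \<xi>_c = pd_nonlinear_part_cubic(4) [of _ z]
  have \<xi>_ta: "d_t (d_a \<xi>) z = 0" and \<tau>_xb: "d_x (d_b \<tau>) z = 0"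
    using linear_part_ax_bct(10) [of z] linear_part_act_bt(12) [of z] by simp_all
  \<comment> \<open>Once \<open>d_t (d_a \<tau>) z\<close> vanishes, the two cited relations say
    that the sum and the difference of these two unknowns are zero. The next pair is treated in the
    same way.\<close>
  have \<tau>_xc: "d_x (d_c \<tau>) z = 0" and B_ab: "d_a (d_b (\<phi> Dep_b)) z = 0"
    using linear_part_bct_at(3) [of z] linear_part_act_bt(11) [of z] \<tau>_a by simp_all
  have \<xi>_tc: "d_t (d_c \<xi>) z = 0" and A_ab: "d_a (d_b (\<phi> Dep_a)) z = 0"
    using linear_part_ax_bct(11) [of z] linear_part_act_bx(2) [of z] \<xi>_b by simp_all
  note base = \<xi>_ta \<tau>_xb \<tau>_xc \<xi>_tc \<xi>_b \<tau>_a \<xi>_a \<xi>_c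
  show base': "d_x (d_a \<xi>) z = 0" "d_x (d_b \<xi>) z = 0" "d_x (d_c \<xi>) z = 0"
    "d_t (d_a \<xi>) z = 0" "d_t (d_b \<xi>) z = 0" "d_t (d_c \<xi>) z = 0"
    "d_x (d_a \<tau>) z = 0" "d_x (d_b \<tau>) z = 0" "d_x (d_c \<tau>) z = 0"
    "d_t (d_a \<tau>) z = 0" "d_t (d_b \<tau>) z = 0" "d_t (d_c \<tau>) z = 0"
    using base \<xi>_a [of "Base Ind_t"] \<xi>_c [of "Base Ind_t"] by simp_all
  have aa: "d_a (d_a (\<phi> Dep_a)) z = 0" "d_a (d_a (\<phi> Dep_b)) z = 0" "d_a (d_a (\<phi> Dep_c)) z = 0"
    using linear_part_ax_bct(3,7) [of z] linear_part_bct_at(4) [of z] base' by simp_all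
  have bb: "d_b (d_b (\<phi> Dep_a)) z = 0" "d_b (d_b (\<phi> Dep_b)) z = 0" "d_b (d_b (\<phi> Dep_c)) z = 0"
    using linear_part_act_bx(3) [of z] linear_part_act_bt(5,19) [of z] base' by simp_all
  have ac: "d_a (d_c (\<phi> Dep_a)) z = 0" "d_a (d_c (\<phi> Dep_b)) z = 0" "d_a (d_c (\<phi> Dep_c)) z = 0"
    using linear_part_ax_bct(4,8) [of z] linear_part_bct_at(5) [of z] base' B_ab by simp_all
  have bc: "d_b (d_c (\<phi> Dep_a)) z = 0" "d_b (d_c (\<phi> Dep_b)) z = 0" "d_b (d_c (\<phi> Dep_c)) z = 0"
    using linear_part_act_bx(6) [of z] linear_part_act_bt(4,18) [of z] base' A_ab by simp_all
  have cc: "d_c (d_c (\<phi> Dep_a)) z = 0" "d_c (d_c (\<phi> Dep_b)) z = 0" "d_c (d_c (\<phi> Dep_c)) z = 0"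
    using linear_part_bct_at(2) [of z] linear_part_act_bt(3,17) [of z] base' aa bb ac by simp_all
  have C_ab: "d_a (d_b (\<phi> Dep_c)) z = 0"
    using linear_part_act_bx(5) [of z] base' bc by simp
  show "d_a (d_a (\<phi> \<alpha>)) z = 0" "d_a (d_b (\<phi> \<alpha>)) z = 0" "d_a (d_c (\<phi> \<alpha>)) z = 0"
    "d_b (d_b (\<phi> \<alpha>)) z = 0" "d_b (d_c (\<phi> \<alpha>)) z = 0" "d_c (d_c (\<phi> \<alpha>)) z = 0"
    using aa bb ac bc cc A_ab B_ab C_ab by (cases \<alpha>; simp)+
qed

text \<open>All fibre derivatives of the \<open>\<phi> \<alpha>\<close> are thereby expressed
  through the Jacobian of \<open>\<xi>\<close> and \<open>\<tau>\<close> in x, t and the single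
  further function \<open>d_a (\<phi> Dep_a)\<close>, the source of the scaling constant
  \<open>k7\<close>.\<close>

lemma nonlinear_part_quadratic:
  shows "d_b (\<phi> Dep_c) z = d_t \<xi> z" "d_a (\<phi> Dep_c) z = d_x \<tau> z"
    "d_c (\<phi> Dep_a) z = 2 * d_t \<xi> z" "d_b (\<phi> Dep_a) z = 0"
    "d_a (\<phi> Dep_b) z = 0" "d_c (\<phi> Dep_b) z = 2 * d_x \<tau> z"
    "d_c (\<phi> Dep_c) z = d_a (\<phi> Dep_a) z + d_t \<tau> z - d_x \<xi> z"
    "d_b (\<phi> Dep_b) z = d_a (\<phi> Dep_a) z + 2 * d_t \<tau> z - 2 * d_x \<xi> z"
proof -
  note vertical = base_coefficients_vertical second_order_vertical
  have E: "E4 (first_jet z u 0 0 v 0 u) = 0" "E5 (first_jet z u 0 0 v 0 u) = 0"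
    "E6 (first_jet z u 0 0 v v 0) = 0" "E5 (first_jet z u 0 0 v v 0) = 0" for u v
    by (rule E_first_jet; simp)+
  note G = cubic_grid [where P = "\<lambda>u v. E4 (first_jet z u 0 0 v 0 u) = 0", OF E(1),
      unfolded E4_def expand vertical, simplified, simplified algebra_simps]
  have 1: "d_a (\<phi> Dep_a) z - d_x \<xi> z - d_c (\<phi> Dep_c) z + d_t \<tau> z = 0"
    "d_c (\<phi> Dep_a) z - d_b (\<phi> Dep_c) z - d_t \<xi> z = 0" "d_b (\<phi> Dep_a) z = 0"
    using G by linarith+
  note G = cubic_grid [where P = "\<lambda>u v. E5 (first_jet z u 0 0 v 0 u) = 0", OF E(2),
      unfolded E5_def expand vertical, simplified, simplified algebra_simps]
  have 2: "d_a (\<phi> Dep_c) z = d_x \<tau> z"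
    using G by linarith+
  note G = cubic_grid [where P = "\<lambda>u v. E6 (first_jet z u 0 0 v v 0) = 0", OF E(3),
      unfolded E6_def expand vertical, simplified, simplified algebra_simps]
  have 3: "d_a (\<phi> Dep_b) z = 0" "d_c (\<phi> Dep_b) z - d_x \<tau> z - d_a (\<phi> Dep_c) z = 0"
    "d_x \<xi> z + d_b (\<phi> Dep_b) z - d_c (\<phi> Dep_c) z - d_t \<tau> z = 0"
    using G by linarith+
  note G = cubic_grid [where P = "\<lambda>u v. E5 (first_jet z u 0 0 v v 0) = 0", OF E(4),
      unfolded E5_def expand vertical, simplified, simplified algebra_simps]
  have 4: "d_b (\<phi> Dep_c) z = d_t \<xi> z"
    using G by linarith+
  show "d_b (\<phi> Dep_c) z = d_t \<xi> z" "d_a (\<phi> Dep_c) z = d_x \<tau> z"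
    "d_c (\<phi> Dep_a) z = 2 * d_t \<xi> z" "d_b (\<phi> Dep_a) z = 0"
    "d_a (\<phi> Dep_b) z = 0" "d_c (\<phi> Dep_b) z = 2 * d_x \<tau> z"
    "d_c (\<phi> Dep_c) z = d_a (\<phi> Dep_a) z + d_t \<tau> z - d_x \<xi> z"
    "d_b (\<phi> Dep_b) z = d_a (\<phi> Dep_a) z + 2 * d_t \<tau> z - 2 * d_x \<xi> z"
    using 1 2 3 4 by linarith+
qed

end

section \<open>Functions with constant partial derivatives\<close>

lemma frechet_derivative_pd:
  assumes "g differentiable (at z)"
  shows "frechet_derivative g (at z) (x, t, a, b, c) =
    x * pd (Base Ind_x) g z + t * pd (Base Ind_t) g z + a * pd a_0 g z + b * pd b_0 g z + c * pd c_0 g z"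
proof -
  have "(x, t, a, b, c) = x *\<^sub>R coord_dir (Base Ind_x) + t *\<^sub>R coord_dir (Base Ind_t)
      + a *\<^sub>R coord_dir a_0 + b *\<^sub>R coord_dir b_0 + c *\<^sub>R coord_dir c_0"
    by simp
  then show ?thesis
    using linear_frechet_derivative [OF assms]
    by (simp only: linear_add linear_cmul pd_def real_scaleR_def)
qed

text \<open>The derivative is the same linear map everywhere; subtracting this map from
  \<open>g\<close> leaves a function with zero derivative, hence a constant.\<close>

lemma constant_pd_imp_affine:
  fixes g :: "point \<Rightarrow> real"
  assumes g: "\<And>z. g differentiable (at z)"
    and pd: "\<And>v z. v \<in> {Base Ind_x, Base Ind_t, a_0, b_0, c_0} \<Longrightarrow> pd v g z = pd v g 0"
  shows "g (x, t, a, b, c) = g 0 + pd (Base Ind_x) g 0 * x + pd (Base Ind_t) g 0 * t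
    + pd a_0 g 0 * a + pd b_0 g 0 * b + pd c_0 g 0 * c"
proof -
  let ?L = "frechet_derivative g (at 0)"
  have "frechet_derivative g (at z) = ?L" for z
  proof (rule ext)
    fix h :: point
    have "pd (Base Ind_x) g z = pd (Base Ind_x) g 0" "pd (Base Ind_t) g z = pd (Base Ind_t) g 0"
      "pd a_0 g z = pd a_0 g 0" "pd b_0 g z = pd b_0 g 0" "pd c_0 g z = pd c_0 g 0"
      by (rule pd; simp)+
    then show "frechet_derivative g (at z) h = ?L h"
      by (cases h) (simp only: frechet_derivative_pd [OF g])
  qed
  then have g': "(g has_derivative ?L) (at z)" for z
    using g frechet_derivative_works by metis
  have "((\<lambda>z. g z - ?L z) has_derivative (\<lambda>h. ?L h - ?L h)) (at z)" for z
    by (intro has_derivative_diff g' bounded_linear_imp_has_derivative has_derivative_bounded_linear [OF g'])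
  then obtain k where k: "\<And>z. g z - ?L z = k"
    using has_derivative_zero_constant [of UNIV "\<lambda>z. g z - ?L z"] by auto
  have "?L 0 = 0"
    using g by (simp add: linear_frechet_derivative linear_0)
  with k [of 0] k [of "(x, t, a, b, c)"] show ?thesis
    using frechet_derivative_pd [OF g, of 0 x t a b c] by (simp add: algebra_simps)
qed

section \<open>The field is affine\<close>

context walker_symmetry
begin

lemma pd_nonlinear_part_quadratic:
  shows "pd v (d_b (\<phi> Dep_c)) z = pd v (d_t \<xi>) z" "pd v (d_a (\<phi> Dep_c)) z = pd v (d_x \<tau>) z"
    "pd v (d_c (\<phi> Dep_a)) z = 2 * pd v (d_t \<xi>) z" "pd v (d_b (\<phi> Dep_a)) z = 0"
    "pd v (d_a (\<phi> Dep_b)) z = 0" "pd v (d_c (\<phi> Dep_b)) z = 2 * pd v (d_x \<tau>) z"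
proof -
  have scale: "pd v (\<lambda>z. 2 * g z) z = 2 * pd v g z" if "C_k (Suc 0) g" for g
  proof -
    have "((\<lambda>z. 2 * g z) has_derivative (\<lambda>h. 2 * frechet_derivative g (at z) h)) (at z)"
      using C_k_differentiable [OF that, of z] unfolding frechet_derivative_works
      by (rule has_derivative_mult_right)
    then show ?thesis
      by (simp add: pd_def frechet_derivative_at [symmetric])
  qed
  have "d_b (\<phi> Dep_c) = d_t \<xi>" "d_a (\<phi> Dep_c) = d_x \<tau>" "d_c (\<phi> Dep_a) = (\<lambda>z. 2 * d_t \<xi> z)"
    "d_b (\<phi> Dep_a) = (\<lambda>z. 0)" "d_a (\<phi> Dep_b) = (\<lambda>z. 0)" "d_c (\<phi> Dep_b) = (\<lambda>z. 2 * d_x \<tau> z)"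
    using nonlinear_part_quadratic by auto
  then show "pd v (d_b (\<phi> Dep_c)) z = pd v (d_t \<xi>) z" "pd v (d_a (\<phi> Dep_c)) z = pd v (d_x \<tau>) z"
    "pd v (d_c (\<phi> Dep_a)) z = 2 * pd v (d_t \<xi>) z" "pd v (d_b (\<phi> Dep_a)) z = 0"
    "pd v (d_a (\<phi> Dep_b)) z = 0" "pd v (d_c (\<phi> Dep_b)) z = 2 * pd v (d_x \<tau>) z"
    using scale [OF C_k_pd [OF C_k_components(1)]] scale [OF C_k_pd [OF C_k_components(2)]] by simp_all
qed

text \<open>The derivatives in x and t of the quadratic relations, together with the four linear
  parts, form a linear system that is solved one unknown at a time.\<close>

lemma second_order_mixed:
  shows "d_x (d_x \<xi>) z = 0" "d_x (d_t \<xi>) z = 0" "d_t (d_t \<xi>) z = 0"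
    and "d_x (d_x \<tau>) z = 0" "d_x (d_t \<tau>) z = 0" "d_t (d_t \<tau>) z = 0"
    and "d_x (d_a (\<phi> \<alpha>)) z = 0" "d_x (d_b (\<phi> \<alpha>)) z = 0" "d_x (d_c (\<phi> \<alpha>)) z = 0"
    "d_t (d_a (\<phi> \<alpha>)) z = 0" "d_t (d_b (\<phi> \<alpha>)) z = 0" "d_t (d_c (\<phi> \<alpha>)) z = 0"
proof -
  note x = pd_nonlinear_part_quadratic [of "Base Ind_x" z]
    and t = pd_nonlinear_part_quadratic [of "Base Ind_t" z, unfolded mixed]
  note linear_bt = linear_part_act_bt [of z] and linear_ax = linear_part_ax_bct [of z]
    and linear_bx = linear_part_act_bx [of z] and linear_at = linear_part_bct_at [of z]
  have xx: "d_x (d_x \<tau>) z = 0" "d_x (d_a (\<phi> Dep_c)) z = 0" "d_x (d_c (\<phi> Dep_b)) z = 0"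
    using linear_at(1) x t by simp_all
  have tt: "d_t (d_t \<xi>) z = 0" "d_t (d_b (\<phi> Dep_c)) z = 0" "d_t (d_c (\<phi> Dep_a)) z = 0"
    using linear_bx(1) x t by simp_all
  \<comment> \<open>The two cited relations differ only by a multiple of this derivative;
    \<open>A_xc\<close> below arises in the same way.\<close>
  have B_tc: "d_t (d_c (\<phi> Dep_b)) z = 0"
    using linear_bt(1) linear_ax(1) by simp
  then have xt: "d_x (d_t \<tau>) z = 0" "d_t (d_a (\<phi> Dep_c)) z = 0"
    using t by simp_all
  then have A_xa: "d_x (d_a (\<phi> Dep_a)) z = 0" "d_x (d_x \<xi>) z = 0"
    using linear_at(6) linear_ax(1) by simp_all
  have A_xc: "d_x (d_c (\<phi> Dep_a)) z = 0"
    using linear_bt(2) linear_ax(2) by simp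
  then have tx: "d_x (d_t \<xi>) z = 0" "d_x (d_b (\<phi> Dep_c)) z = 0"
    using x by simp_all
  then have B_tb: "d_t (d_b (\<phi> Dep_b)) z = 0" "d_t (d_t \<tau>) z = 0"
    using linear_bx(4) linear_bt(2) by simp_all
  have rest: "d_t (d_a (\<phi> Dep_a)) z = 0" "d_x (d_b (\<phi> Dep_b)) z = 0"
    "d_x (d_c (\<phi> Dep_c)) z = 0" "d_t (d_c (\<phi> Dep_c)) z = 0"
    using linear_ax(9,6) linear_bt(10,16) xt tx A_xa A_xc B_tb B_tc by simp_all
  note all = xx tt B_tc xt A_xa A_xc tx B_tb rest x(4,5) t(4,5)
  show "d_x (d_x \<xi>) z = 0" "d_x (d_t \<xi>) z = 0" "d_t (d_t \<xi>) z = 0"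
    "d_x (d_x \<tau>) z = 0" "d_x (d_t \<tau>) z = 0" "d_t (d_t \<tau>) z = 0"
    by (fact all)+
  show "d_x (d_a (\<phi> \<alpha>)) z = 0" "d_x (d_b (\<phi> \<alpha>)) z = 0" "d_x (d_c (\<phi> \<alpha>)) z = 0"
    "d_t (d_a (\<phi> \<alpha>)) z = 0" "d_t (d_b (\<phi> \<alpha>)) z = 0" "d_t (d_c (\<phi> \<alpha>)) z = 0"
    by (cases \<alpha>; simp add: all)+
qed

text \<open>The only second derivatives still present are those of the
  \<open>\<phi> \<alpha>\<close> in x and t, which enter the constant term. The coefficients of
  \<open>u\<close> and \<open>v\<close> therefore consist of first derivatives of the
  \<open>\<phi> \<alpha>\<close> in x and t.\<close>

lemma nonlinear_part_linear:
  "d_x (\<phi> \<alpha>) z = 0" "d_t (\<phi> \<alpha>) z = 0"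
proof -
  note second_order = base_coefficients_vertical second_order_vertical second_order_mixed
  have E: "E4 (first_jet z u 0 0 v 0 u) = 0" "E5 (first_jet z u 0 0 v 0 u) = 0"
    "E4 (first_jet z u 0 0 v v 0) = 0" "E6 (first_jet z u 0 0 v v 0) = 0" for u v
    by (rule E_first_jet; simp)+
  note G = cubic_grid [where P = "\<lambda>u v. E4 (first_jet z u 0 0 v 0 u) = 0", OF E(1),
      unfolded E4_def expand second_order nonlinear_part_cubic, simplified, simplified algebra_simps]
  have 1: "d_t (\<phi> Dep_a) z = 0" "d_x (\<phi> Dep_a) z - d_t (\<phi> Dep_c) z = 0"
    using G by linarith+
  note G = cubic_grid [where P = "\<lambda>u v. E5 (first_jet z u 0 0 v 0 u) = 0", OF E(2),
      unfolded E5_def expand second_order nonlinear_part_cubic, simplified, simplified algebra_simps]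
  have 2: "d_x (\<phi> Dep_c) z = 0"
    using G by linarith+
  note G = cubic_grid [where P = "\<lambda>u v. E4 (first_jet z u 0 0 v v 0) = 0", OF E(3),
      unfolded E4_def expand second_order nonlinear_part_cubic, simplified, simplified algebra_simps]
  have 3: "d_t (\<phi> Dep_c) z = 0"
    using G by linarith+
  note G = cubic_grid [where P = "\<lambda>u v. E6 (first_jet z u 0 0 v v 0) = 0", OF E(4),
      unfolded E6_def expand second_order nonlinear_part_cubic, simplified, simplified algebra_simps]
  have 4: "d_x (\<phi> Dep_b) z = 0" "d_t (\<phi> Dep_b) z - d_x (\<phi> Dep_c) z = 0"
    using G by linarith+
  show "d_x (\<phi> \<alpha>) z = 0" "d_t (\<phi> \<alpha>) z = 0"
    using 1 2 3 4 by (cases \<alpha>; simp)+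
qed

lemma second_order_base:
  "d_x (d_x (\<phi> \<alpha>)) z = 0" "d_x (d_t (\<phi> \<alpha>)) z = 0" "d_t (d_t (\<phi> \<alpha>)) z = 0"
proof -
  have "d_x (\<phi> \<alpha>) = (\<lambda>z. 0)" "d_t (\<phi> \<alpha>) = (\<lambda>z. 0)"
    using nonlinear_part_linear by auto
  then show "d_x (d_x (\<phi> \<alpha>)) z = 0" "d_x (d_t (\<phi> \<alpha>)) z = 0" "d_t (d_t (\<phi> \<alpha>)) z = 0"
    by simp_all
qed

lemma pd_constant:
  assumes "v \<in> {Base Ind_x, Base Ind_t, a_0, b_0, c_0}"
  shows "pd v \<xi> z = pd v \<xi> 0" "pd v \<tau> z = pd v \<tau> 0" "pd v (\<phi> \<alpha>) z = pd v (\<phi> \<alpha>) 0"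
proof -
  note second_order = base_coefficients_vertical second_order_vertical second_order_mixed second_order_base mixed
  \<comment> \<open>This is applied to the first derivatives of the components, whose own
    derivatives are second derivatives of the field and all vanish.\<close>
  have const: "g z = g 0" if "C_k (Suc 0) g"
    and "\<And>z w. w \<in> {Base Ind_x, Base Ind_t, a_0, b_0, c_0} \<Longrightarrow> pd w g z = 0" for g
  proof -
    obtain x t a b c where "z = (x, t, a, b, c)"
      by (cases z)
    then show ?thesis
      using constant_pd_imp_affine [of g x t a b c] C_k_differentiable [OF that(1)] that(2) by simp
  qed
  show "pd v \<xi> z = pd v \<xi> 0" "pd v \<tau> z = pd v \<tau> 0" "pd v (\<phi> \<alpha>) z = pd v (\<phi> \<alpha>) 0"
    by (rule const [OF C_k_pd [OF C_k_components(1)]] const [OF C_k_pd [OF C_k_components(2)]]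
        const [OF C_k_pd [OF C_k_components(3)]]; use assms in \<open>auto simp: second_order\<close>)+
qed

text \<open>
  Over the origin, where \<open>a = b = c = 0\<close>, the last three equations do not restrict the second derivatives.
\<close>

lemma first_order_at_origin:
  shows "\<phi> \<alpha> 0 = 0" "d_a \<xi> 0 = 0" "d_c \<xi> 0 = 0"
proof -
  note second_order = base_coefficients_vertical second_order_vertical second_order_mixed second_order_base
    nonlinear_part_linear nonlinear_part_cubic nonlinear_part_quadratic
  \<comment> \<open>The repeated entries and signs solve the three linear equations. With
    \<open>a_x\<close> as the only nonzero first derivative, every quadratic term vanishes too, so
    all five parameters are free.\<close>
  define j where "j u p q r s = mk_jet 0 ((\<lambda>_. 0)(a_x := u, a_tt := p, c_xt := q, a_xt := r, c_tt := - r,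
    b_xt := - s, c_xx := s, a_xx := q, b_tt := q))" for u p q r s
  have zero: "dep_comp \<alpha> 0 = 0" for \<alpha>
    by (cases \<alpha>) (simp_all add: zero_prod_def)
  have j: "base_point (j u p q r s) = 0" "j u p q r s (Jet \<alpha> (0, 0)) = 0"
    "j u p q r s a_x = u" "j u p q r s a_t = 0" "j u p q r s b_x = 0" "j u p q r s b_t = 0"
    "j u p q r s c_x = 0" "j u p q r s c_t = 0" "j u p q r s a_xx = q" "j u p q r s a_xt = r"
    "j u p q r s a_tt = p" "j u p q r s b_xx = 0" "j u p q r s b_xt = - s" "j u p q r s b_tt = q"
    "j u p q r s c_xx = s" "j u p q r s c_xt = q" "j u p q r s c_tt = - r" for u p q r s \<alpha>
    by (cases \<alpha>; simp add: j_def zero numeral_2_eq_2)+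
  have E: "E1 (j u p q r s) = 0" "E4 (j u p q r s) = 0" for u p q r s
    by (rule E_eq_0; simp only: j; simp)+
  have E4: "2 * \<phi> Dep_c 0 * r + \<phi> Dep_b 0 * p - \<phi> Dep_a 0 * q = 0" for p q r
    using E(2) [of 0 p q r 0] unfolding E4_def coeff1_def j by simp
  \<comment> \<open>Setting one of \<open>p\<close>, \<open>q\<close>, \<open>r\<close> to 1 and the
    others to 0 isolates one component at a time.\<close>
  show "\<phi> \<alpha> 0 = 0"
    using E4 [of 1 0 0] E4 [of 0 1 0] E4 [of 0 0 1] by (cases \<alpha>) simp_all
  have E1: "E1 (j u 0 q 0 s) = 0" for u q s
    by (rule E)
  note j_simps = j [simplified] j [unfolded numeral_2_eq_2, simplified]
  note E1 = E1 [unfolded E1_def coeff2_def D2_def D1_def mixed second_order]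
  \<comment> \<open>Comparing \<open>u = 1\<close> with \<open>u = - 1\<close> isolates the terms
    with \<open>u * q\<close>, whose coefficient is a nonzero multiple of
    \<open>d_a \<xi> 0\<close>. For \<open>d_c \<xi> 0\<close> the terms with \<open>u * s\<close>
    play this role.\<close>
  show "d_a \<xi> 0 = 0"
    using nonlinear_part_cubic(3) [of 0] E1 [of 1 1 0] E1 [of "- 1" 1 0] by (simp add: j_simps numeral_2_eq_2)
  show "d_c \<xi> 0 = 0"
    using nonlinear_part_cubic(4) [of 0] E1 [of 1 0 1] E1 [of "- 1" 0 1] by (simp add: j_simps numeral_2_eq_2)
qed

end

section \<open>The symmetries\<close>

definition affine_fun :: "real \<Rightarrow> real \<Rightarrow> real \<Rightarrow> real \<Rightarrow> real \<Rightarrow> real \<Rightarrow> point \<Rightarrow> real" where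
  "affine_fun k l\<^sub>x l\<^sub>t l\<^sub>a l\<^sub>b l\<^sub>c = (\<lambda>(x, t, a, b, c). k + l\<^sub>x * x + l\<^sub>t * t + l\<^sub>a * a + l\<^sub>b * b + l\<^sub>c * c)"

lemma has_derivative_affine_fun:
  "(affine_fun k l\<^sub>x l\<^sub>t l\<^sub>a l\<^sub>b l\<^sub>c has_derivative affine_fun 0 l\<^sub>x l\<^sub>t l\<^sub>a l\<^sub>b l\<^sub>c) (at z)"
  unfolding affine_fun_def case_prod_unfold by (auto intro!: derivative_eq_intros)

lemma pd_affine_fun:
  "pd (Base Ind_x) (affine_fun k l\<^sub>x l\<^sub>t l\<^sub>a l\<^sub>b l\<^sub>c) = (\<lambda>z. l\<^sub>x)"
  "pd (Base Ind_t) (affine_fun k l\<^sub>x l\<^sub>t l\<^sub>a l\<^sub>b l\<^sub>c) = (\<lambda>z. l\<^sub>t)"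
  "pd a_0 (affine_fun k l\<^sub>x l\<^sub>t l\<^sub>a l\<^sub>b l\<^sub>c) = (\<lambda>z. l\<^sub>a)"
  "pd b_0 (affine_fun k l\<^sub>x l\<^sub>t l\<^sub>a l\<^sub>b l\<^sub>c) = (\<lambda>z. l\<^sub>b)"
  "pd c_0 (affine_fun k l\<^sub>x l\<^sub>t l\<^sub>a l\<^sub>b l\<^sub>c) = (\<lambda>z. l\<^sub>c)"
  unfolding fun_eq_iff pd_def frechet_derivative_at [OF has_derivative_affine_fun, symmetric]
  by (simp_all add: affine_fun_def)

section \<open>The seven-parameter family consists of symmetries\<close>

definition walker_field :: "real \<Rightarrow> real \<Rightarrow> real \<Rightarrow> real \<Rightarrow> real \<Rightarrow> real \<Rightarrow> real \<Rightarrow> point \<Rightarrow> point" where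
  "walker_field k1 k2 k3 k4 k5 k6 k7 = (\<lambda>(x, t, a, b, c).
        (k3 * x + k1 * t + k2,
         k6 * x + k4 * t + k5,
         2 * k1 * c + k7 * a,
         (2 * k4 - 2 * k3 + k7) * b + 2 * k6 * c,
         (k7 + k4 - k3) * c + k6 * a + k1 * b))"

lemma smooth_walker_field: "smooth (walker_field k1 k2 k3 k4 k5 k6 k7)"
proof -
  \<comment> \<open>Dropping the translations \<open>k2\<close> and \<open>k5\<close> leaves the
    linear part of the field.\<close>
  let ?L = "walker_field k1 0 k3 k4 0 k6 k7"
  have "linear ?L"
    by (rule linearI) (auto simp: walker_field_def algebra_simps)
  then have "smooth (\<lambda>z. ?L z + (k2, k5, 0, 0, 0))"
    by (intro smooth_affine) (simp add: linear_conv_bounded_linear)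
  then show ?thesis
    by (simp add: walker_field_def case_prod_unfold)
qed

lemma walker_field_components:
  "(\<lambda>z. indep_comp Ind_x (walker_field k1 k2 k3 k4 k5 k6 k7 z)) = affine_fun k2 k3 k1 0 0 0"
  "(\<lambda>z. indep_comp Ind_t (walker_field k1 k2 k3 k4 k5 k6 k7 z)) = affine_fun k5 k6 k4 0 0 0"
  "(\<lambda>z. dep_comp Dep_a (walker_field k1 k2 k3 k4 k5 k6 k7 z)) = affine_fun 0 0 0 k7 0 (2 * k1)"
  "(\<lambda>z. dep_comp Dep_b (walker_field k1 k2 k3 k4 k5 k6 k7 z)) = affine_fun 0 0 0 0 (2 * k4 - 2 * k3 + k7) (2 * k6)"
  "(\<lambda>z. dep_comp Dep_c (walker_field k1 k2 k3 k4 k5 k6 k7 z)) = affine_fun 0 0 0 k6 k1 (k7 + k4 - k3)"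
  by (auto simp: walker_field_def affine_fun_def)

text \<open>The identities hold at every jet, not only where the system is satisfied. Some
  multipliers contain undifferentiated \<open>a\<close>, \<open>b\<close>, \<open>c\<close>,
  compensating the second-order terms of the nonlinear equations by the linear ones.\<close>

lemma prolong2_walker_field:
  fixes k1 k2 k3 k4 k5 k6 k7 :: real
  defines "X \<equiv> walker_field k1 k2 k3 k4 k5 k6 k7"
  shows "prolong2 X delta1 p = (k7 - 2 * k3) * delta1 p + 2 * k1 * delta2 p - 2 * k6 * delta3 p"
    and "prolong2 X delta2 p = (k7 + k4 - 3 * k3) * delta2 p + k6 * delta1 p"
    and "prolong2 X delta3 p = (k7 - k3 - k4) * delta3 p - k1 * delta1 p"
    and "prolong2 X delta4 p = (2 * k7 - 2 * k3) * delta4 p - 2 * k1 * delta5 p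
      - k1 * p a_0 * delta2 p + k6 * p a_0 * delta3 p"
    and "prolong2 X delta5 p = (2 * k7 - 3 * k3 + k4) * delta5 p - k1 * delta6 p - k6 * delta4 p
      + k1 * p b_0 * delta1 p + k1 * p c_0 * delta2 p - k6 * p c_0 * delta3 p"
    and "prolong2 X delta6 p = (2 * k7 - 4 * k3 + 2 * k4) * delta6 p - 2 * k6 * delta5 p
      + k1 * p b_0 * delta2 p - k6 * p b_0 * delta3 p + 2 * k6 * p c_0 * delta1 p"
proof -
  interpret vector_field X
    unfolding X_def by unfold_locales (rule smooth_walker_field)
  note components = walker_field_components [of k1 k2 k3 k4 k5 k6 k7, folded X_def]
  note expand = E1_def E2_def E3_def E4_def E5_def E6_def coeff1_def coeff2_def D1_def D2_def
    components components [THEN fun_cong] pd_affine_fun pd_const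
  note evaluate = affine_fun_def base_point_def numeral_2_eq_2
  show "prolong2 X delta1 p = (k7 - 2 * k3) * delta1 p + 2 * k1 * delta2 p - 2 * k6 * delta3 p"
    "prolong2 X delta2 p = (k7 + k4 - 3 * k3) * delta2 p + k6 * delta1 p"
    "prolong2 X delta3 p = (k7 - k3 - k4) * delta3 p - k1 * delta1 p"
    "prolong2 X delta4 p = (2 * k7 - 2 * k3) * delta4 p - 2 * k1 * delta5 p
      - k1 * p a_0 * delta2 p + k6 * p a_0 * delta3 p"
    "prolong2 X delta5 p = (2 * k7 - 3 * k3 + k4) * delta5 p - k1 * delta6 p - k6 * delta4 p
      + k1 * p b_0 * delta1 p + k1 * p c_0 * delta2 p - k6 * p c_0 * delta3 p"
    "prolong2 X delta6 p = (2 * k7 - 4 * k3 + 2 * k4) * delta6 p - 2 * k6 * delta5 p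
      + k1 * p b_0 * delta2 p - k6 * p b_0 * delta3 p + 2 * k6 * p c_0 * delta1 p"
    unfolding prolong2_walker_einstein_system expand by (simp add: evaluate, algebra)+
qed

lemma infinitesimal_symmetry_walker_field:
  "infinitesimal_symmetry walker_einstein_system (walker_field k1 k2 k3 k4 k5 k6 k7)"
proof -
  have "\<forall>\<Delta>\<in>walker_einstein_system. prolong2 (walker_field k1 k2 k3 k4 k5 k6 k7) \<Delta> p = 0"
    if "\<forall>\<Delta>\<in>walker_einstein_system. \<Delta> p = 0" for p
    using that unfolding walker_einstein_system_def ball_simps prolong2_walker_field
    by (elim conjE) (simp only: mult_zero_right diff_zero add_0_right simp_thms)
  then show ?thesis
    unfolding infinitesimal_symmetry_def using smooth_walker_field by blast
qed

section \<open>Every symmetry belongs to the family\<close>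

context walker_symmetry
begin

lemma eq_walker_field: "\<exists>k1 k2 k3 k4 k5 k6 k7. X = walker_field k1 k2 k3 k4 k5 k6 k7"
proof -
  \<comment> \<open>The seven constants are the values and first derivatives at the origin that the
    relations leave free; all other coefficients of the affine components are zero or expressed
    through them.\<close>
  have "X z = walker_field (d_t \<xi> 0) (\<xi> 0) (d_x \<xi> 0) (d_t \<tau> 0) (\<tau> 0) (d_x \<tau> 0) (d_a (\<phi> Dep_a) 0) z" for z
  proof -
    obtain x t a b c where z: "z = (x, t, a, b, c)"
      by (cases z)
    obtain x' t' a' b' c' where X: "X z = (x', t', a', b', c')"
      by (cases "X z")
    note affine = constant_pd_imp_affine [OF C_k_differentiable [OF C_k_components(1)] pd_constant(1), of x t a b c]
      constant_pd_imp_affine [OF C_k_differentiable [OF C_k_components(2)] pd_constant(2), of x t a b c]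
      constant_pd_imp_affine [OF C_k_differentiable [OF C_k_components(3)] pd_constant(3), of _ x t a b c]
    have \<tau>: "d_b \<tau> 0 = 0" "d_c \<tau> 0 = 0"
      using first_order_at_origin(2,3) nonlinear_part_cubic(3,4) [of 0] by simp_all
    note first_order = \<tau> first_order_at_origin nonlinear_part_cubic(1,2) nonlinear_part_quadratic nonlinear_part_linear
    show ?thesis
      using affine(1,2) affine(3) [of Dep_a] affine(3) [of Dep_b] affine(3) [of Dep_c]
      unfolding first_order z [symmetric] X by (simp add: X z walker_field_def first_order algebra_simps)
  qed
  then show ?thesis
    by (intro exI ext)
qed

end

theorem theorem3p1:
  shows "point_symmetry_algebra walker_einstein_system =
    {X. \<exists>k1 k2 k3 k4 k5 k6 k7 :: real. X = (\<lambda>(x, t, a, b, c).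
        (k3 * x + k1 * t + k2,
         k6 * x + k4 * t + k5,
         2 * k1 * c + k7 * a,
         (2 * k4 - 2 * k3 + k7) * b + 2 * k6 * c,
         (k7 + k4 - k3) * c + k6 * a + k1 * b))}"
  unfolding walker_field_def [symmetric] point_symmetry_algebra_def
proof (intro set_eqI iffI; unfold mem_Collect_eq)
  fix X
  assume X: "infinitesimal_symmetry walker_einstein_system X"
  then interpret walker_symmetry X
    by unfold_locales (auto simp: infinitesimal_symmetry_def)
  show "\<exists>k1 k2 k3 k4 k5 k6 k7. X = walker_field k1 k2 k3 k4 k5 k6 k7"
    by (rule eq_walker_field)
next
  fix X
  assume "\<exists>k1 k2 k3 k4 k5 k6 k7. X = walker_field k1 k2 k3 k4 k5 k6 k7"
  then show "infinitesimal_symmetry walker_einstein_system X"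
    using infinitesimal_symmetry_walker_field by blast
qed

end
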